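(* Let $n\ge 1$ be an odd integer and let $V$ be an $n$-dimensional Chebyshev system on the circle $S^1=\mathbb{R}/2\pi\mathbb{Z}$. If $f:S^1\to\mathbb{R}$ is a continuous function with at least $n+1$ sign changes, then there exists an orientation preserving diffeomorphism $\varphi:S^1\to S^1$ such that $f(\varphi(x))$ is $L^2$-orthogonal to $V$, i.e. $\int_0^{2\pi} f(\varphi(x))\,g(x)\,dx=0$ for every $g\in V$.
   Context: A Chebyshev system on $S^1=\mathbb{R}/2\pi\mathbb{Z}$ is an $n$-dimensional space $V$ of (real-valued) functions on $S^1$, where $n$ is odd, such that every non-zero function from $V$ has at most $n-1$ zeros, counted with multiplicities. A continuous function $f$ on $S^1$ has at least $m$ sign changes ($m$ even) if there are $m$ cyclically ordered distinct points of $S^1$ at which $f$ is non-zero and takes values of alternating signs (cyclically). *)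

theory Defs
  imports
    "HOL-Analysis.Analysis"
    "HOL-Library.Function_Algebras"
    "HOL-Library.Extended_Nat"
    "HOL-Library.Periodic_Fun"
begin

text \<open>Pointwise scaling, so that \<open>subspace\<close> and \<open>dim\<close> apply to sets of functions.\<close>

instantiation "fun" :: (type, real_vector) real_vector
begin

definition scaleR_fun :: "real \<Rightarrow> ('a \<Rightarrow> 'b) \<Rightarrow> 'a \<Rightarrow> 'b"
  where "scaleR_fun c f = (\<lambda>x. c *\<^sub>R f x)"

instance
  by standard (simp_all add: scaleR_fun_def fun_eq_iff scaleR_add_right scaleR_add_left)

end

text \<open>
  The circle is the quotient of the reals by \<open>2 * pi\<close>: a function on the circle is a
  \<open>2 * pi\<close>-periodic function on the reals, and a self-map of the circle is represented by a lift.
\<close>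

abbreviation circle_fun :: "(real \<Rightarrow> 'b) \<Rightarrow> bool"
  where "circle_fun f \<equiv> periodic_fun_simple f (2 * pi)"

definition circle_eq :: "real \<Rightarrow> real \<Rightarrow> bool"
  where "circle_eq x y \<longleftrightarrow> (\<exists>k::int. x - y = of_int k * (2 * pi))"

definition C_k :: "nat \<Rightarrow> (real \<Rightarrow> real) \<Rightarrow> bool"
  where "C_k k f \<longleftrightarrow>
    (\<forall>j<k. \<forall>x. (deriv ^^ j) f differentiable (at x)) \<and> continuous_on UNIV ((deriv ^^ k) f)"

definition smooth :: "(real \<Rightarrow> real) \<Rightarrow> bool"
  where "smooth f \<longleftrightarrow> (\<forall>k. C_k k f)"

definition zero_multiplicity :: "(real \<Rightarrow> real) \<Rightarrow> real \<Rightarrow> enat"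
  where "zero_multiplicity f x =
    (if \<forall>k. (deriv ^^ k) f x = 0 then \<infinity> else enat (LEAST k. (deriv ^^ k) f x \<noteq> 0))"

text \<open>The supremum over finite subsets of a fundamental domain is the sum over the circle.\<close>

definition zeros_with_multiplicity :: "(real \<Rightarrow> real) \<Rightarrow> enat"
  where "zeros_with_multiplicity f =
    (SUP Z \<in> {Z. finite Z \<and> Z \<subseteq> {0..<2 * pi}}. \<Sum>x\<in>Z. zero_multiplicity f x)"

text \<open>
  Regularity \<open>n - 1\<close> is what is needed to decide whether there are at most \<open>n - 1\<close> zeros with
  multiplicities: \<open>zero_multiplicity\<close> is less than \<open>n\<close> iff some derivative of order less than \<open>n\<close>
  does not vanish, and then only such derivatives determine it.  Spaces of smooth functions are a
  special case.  Since \<open>n\<close> is odd, hence positive, \<open>dim V = n\<close> makes \<open>V\<close> finite-dimensional.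
\<close>

definition chebyshev_system :: "nat \<Rightarrow> (real \<Rightarrow> real) set \<Rightarrow> bool"
  where "chebyshev_system n V \<longleftrightarrow>
    odd n \<and> subspace V \<and> dim V = n \<and>
    (\<forall>g\<in>V. circle_fun g \<and> C_k (n - 1) g) \<and>
    (\<forall>g\<in>V. g \<noteq> 0 \<longrightarrow> zeros_with_multiplicity g \<le> enat (n - 1))"

text \<open>
  The real numbers \<open>t 0 < \<dots> < t (m - 1) < t 0 + 2 * pi\<close> are lifts of \<open>m\<close> distinct, cyclically
  ordered points of the circle.
\<close>

definition at_least_sign_changes :: "nat \<Rightarrow> (real \<Rightarrow> real) \<Rightarrow> bool"
  where "at_least_sign_changes m f \<longleftrightarrow> even m \<and>
    (\<exists>t::nat \<Rightarrow> real. strict_mono_on {..<m} t \<and> (\<forall>i<m. t i < t 0 + 2 * pi) \<and>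
      (\<forall>i<m. f (t i) * f (t (Suc i mod m)) < 0))"

text \<open>
  Every smooth self-map of the circle has a smooth lift, so an orientation preserving
  diffeomorphism of the circle is represented by a smooth lift \<open>\<phi>\<close> with positive derivative such
  that the induced map has an inverse with a smooth lift \<open>\<psi>\<close>.
\<close>

definition smooth_circle_map :: "(real \<Rightarrow> real) \<Rightarrow> bool"
  where "smooth_circle_map \<phi> \<longleftrightarrow>
    smooth \<phi> \<and> (\<forall>x y. circle_eq x y \<longrightarrow> circle_eq (\<phi> x) (\<phi> y))"

definition circle_diffeomorphism :: "(real \<Rightarrow> real) \<Rightarrow> bool"
  where "circle_diffeomorphism \<phi> \<longleftrightarrow> smooth_circle_map \<phi> \<and>
    (\<exists>\<psi>. smooth_circle_map \<psi> \<and> (\<forall>x. circle_eq (\<psi> (\<phi> x)) x) \<and> (\<forall>x. circle_eq (\<phi> (\<psi> x)) x))"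

definition orientation_preserving :: "(real \<Rightarrow> real) \<Rightarrow> bool"
  where "orientation_preserving \<phi> \<longleftrightarrow> (\<forall>x. deriv \<phi> x > 0)"

end

theory Submission
  imports Defs
begin

text \<open>
  Write \<open>\<phi>\<close> as the inverse of a lift \<open>\<psi>\<close> whose derivative is close to a sum of point masses. The masses
  sit at points where \<open>f\<close> takes nonzero values of alternating signs and at zeros of \<open>f\<close> between
  them, so \<open>f \<circ> \<phi>\<close> is close to a function that vanishes except on short intervals starting at
  equally spaced points \<open>x 0 < \<dots> < x n\<close>, where it takes those values. The lengths of these intervals
  are free. For a Chebyshev system the linear relation between the evaluations at any \<open>n + 1\<close>
  points has coefficients of strictly alternating signs, because the interpolating function that
  is 1 at one node and 0 at the other \<open>n - 1\<close> nodes has only simple zeros. Hence positive lengths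
  proportional to these coefficients make all integrals vanish to first order. In the interpolating basis
  the integrals depend on relative perturbations of the first \<open>n\<close> lengths approximately diagonally, so
  the Poincare-Miranda theorem, obtained from Kuhn's lemma, gives an exact solution.
\<close>

subsection \<open>Smooth functions\<close>

text \<open>The total time is fixed at \<open>2 * pi\<close>, yet the lengths on which
  \<open>f\<close> acts must vary independently. The zeros of \<open>f\<close> reconcile the two:
  whatever part of a block of length \<open>2 * pi / Suc n\<close> is not spent at a sign point is
  spent at the zero after it, at no cost to the integrals, so the starting points \<open>x i\<close>
  never move. Orthogonality is \<open>n\<close> equations in \<open>n + 1\<close> lengths, so the
  last length is held fixed. The inverse lift is built because the substituted integrand
  \<open>f y * (g (\<psi> y) * deriv \<psi> y)\<close> evaluates the merely continuous
  \<open>f\<close> at an unmoved point, while the masses enter \<open>\<psi>\<close> linearly. With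
  lengths of order \<open>h\<close> the linear part is of order \<open>h\<close> and the
  linearization error is o(h). Hence \<open>h\<close> is fixed before the jumps are smoothed, and
  the smoothing error is made small against \<open>h\<close>, uniformly in the lengths, since the
  final lengths depend on the smoothing. Only the sizes of these errors are controlled, not their
  derivatives in the lengths; Poincare-Miranda suits this, as it asks only for continuity and for
  signs on opposite faces.\<close>

lemma C_k_0 [simp]: "C_k 0 f \<longleftrightarrow> continuous_on UNIV f"
  by (simp add: C_k_def)

text \<open>The first derivative is peeled off on the inside, so that the closure properties below
  become inductions on \<open>k\<close>, each fed by one differentiation rule.\<close>

lemma C_k_Suc: "C_k (Suc k) f \<longleftrightarrow> (\<forall>x. f differentiable (at x)) \<and> C_k k (deriv f)"
  unfolding C_k_def All_less_Suc2 by (auto simp: funpow_swap1)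

lemma C_k_SucI:
  assumes "\<And>x. (f has_real_derivative f' x) (at x)" "C_k k f'"
  shows "C_k (Suc k) f"
proof -
  have "deriv f = f'" using assms(1) by (auto intro: DERIV_imp_deriv)
  then show ?thesis using assms by (auto simp: C_k_Suc real_differentiable_def)
qed

lemma C_k_SucE:
  assumes "C_k (Suc k) f"
  obtains f' where "\<And>x. (f has_real_derivative f' x) (at x)" "C_k k f'"
  using assms by (metis C_k_Suc DERIV_deriv_iff_real_differentiable)

lemma C_k_SucD: "C_k (Suc k) f \<Longrightarrow> C_k k f"
proof (induction k arbitrary: f)
  case 0
  then show ?case
    by (auto simp: C_k_Suc continuous_on_eq_continuous_at intro: differentiable_imp_continuous_within)
next
  case (Suc k)
  then show ?case by (metis C_k_Suc)
qed

lemma C_k_imp_continuous: "C_k k f \<Longrightarrow> continuous_on UNIV f"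
  by (induction k) (auto dest: C_k_SucD)

lemma C_k_const: "C_k k (\<lambda>x. c)"
  by (induction k arbitrary: c) (auto intro: C_k_SucI[where f' = "\<lambda>x. 0"])

lemma C_k_add: "C_k k f \<Longrightarrow> C_k k g \<Longrightarrow> C_k k (\<lambda>x. f x + g x)"
proof (induction k arbitrary: f g)
  case 0
  then show ?case by (simp add: continuous_on_add)
next
  case (Suc k)
  obtain f' g' where "\<And>x. (f has_real_derivative f' x) (at x)" "C_k k f'"
    "\<And>x. (g has_real_derivative g' x) (at x)" "C_k k g'"
    using Suc.prems by (auto elim!: C_k_SucE)
  then show ?case using Suc.IH
    by (intro C_k_SucI[where f' = "\<lambda>x. f' x + g' x"]) (auto intro: DERIV_add)
qed

lemma C_k_mult: "C_k k f \<Longrightarrow> C_k k g \<Longrightarrow> C_k k (\<lambda>x. f x * g x)"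
proof (induction k arbitrary: f g)
  case 0
  then show ?case by (simp add: continuous_on_mult)
next
  case (Suc k)
  obtain f' g' where *: "\<And>x. (f has_real_derivative f' x) (at x)" "C_k k f'"
    "\<And>x. (g has_real_derivative g' x) (at x)" "C_k k g'"
    using Suc.prems by (auto elim!: C_k_SucE)
  then show ?case using Suc.IH Suc.prems
    by (intro C_k_SucI[where f' = "\<lambda>x. f' x * g x + g' x * f x"])
      (auto intro!: DERIV_mult C_k_add dest: C_k_SucD)
qed

lemma C_k_compose: "C_k k f \<Longrightarrow> C_k k g \<Longrightarrow> C_k k (\<lambda>x. f (g x))"
proof (induction k arbitrary: f g)
  case 0
  then show ?case by (auto intro: continuous_on_compose2)
next
  case (Suc k)
  obtain f' g' where *: "\<And>x. (f has_real_derivative f' x) (at x)" "C_k k f'"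
    "\<And>x. (g has_real_derivative g' x) (at x)" "C_k k g'"
    using Suc.prems by (auto elim!: C_k_SucE)
  have "C_k k (\<lambda>x. f' (g x))" using Suc * by (blast intro: C_k_SucD)
  then show ?case using *
    by (intro C_k_SucI[where f' = "\<lambda>x. f' (g x) * g' x"])
      (auto intro: DERIV_chain2[where f = f and g = g] C_k_mult)
qed

lemma C_k_inverse: "C_k k f \<Longrightarrow> (\<And>x. f x \<noteq> 0) \<Longrightarrow> C_k k (\<lambda>x. inverse (f x))"
proof (induction k)
  case 0
  then show ?case by (simp add: continuous_on_inverse)
next
  case (Suc k)
  obtain f' where *: "\<And>x. (f has_real_derivative f' x) (at x)" "C_k k f'"
    using Suc.prems by (auto elim!: C_k_SucE)
  have "((\<lambda>x. inverse (f x)) has_real_derivative - 1 * (f' x * (inverse (f x) * inverse (f x)))) (at x)" for x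
    using * Suc.prems by (auto intro!: derivative_eq_intros simp: divide_simps power2_eq_square)
  moreover have "C_k k (\<lambda>x. - 1 * (f' x * (inverse (f x) * inverse (f x))))"
    using * Suc by (intro C_k_mult C_k_const) (auto dest: C_k_SucD)
  ultimately show ?case by (rule C_k_SucI)
qed

lemma smooth_imp_C_k: "smooth f \<Longrightarrow> C_k k f"
  by (simp add: smooth_def)

lemma smooth_const: "smooth (\<lambda>x. c)"
  by (simp add: smooth_def C_k_const)

lemma smooth_add: "smooth f \<Longrightarrow> smooth g \<Longrightarrow> smooth (\<lambda>x. f x + g x)"
  by (simp add: smooth_def C_k_add)

lemma smooth_mult: "smooth f \<Longrightarrow> smooth g \<Longrightarrow> smooth (\<lambda>x. f x * g x)"
  by (simp add: smooth_def C_k_mult)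

lemma smooth_compose: "smooth f \<Longrightarrow> smooth g \<Longrightarrow> smooth (\<lambda>x. f (g x))"
  by (simp add: smooth_def C_k_compose)

lemma smooth_sum: "(\<And>i. i \<in> I \<Longrightarrow> smooth (f i)) \<Longrightarrow> smooth (\<lambda>x. \<Sum>i\<in>I. f i x)"
  by (induction I rule: infinite_finite_induct) (auto intro: smooth_const smooth_add)

lemma smooth_deriv: "smooth f \<Longrightarrow> smooth (deriv f)"
  unfolding smooth_def by (metis C_k_Suc)

lemma smooth_has_deriv: "smooth f \<Longrightarrow> (f has_real_derivative deriv f x) (at x)"
  unfolding smooth_def by (metis C_k_Suc DERIV_deriv_iff_real_differentiable)

lemma smooth_imp_continuous: "smooth f \<Longrightarrow> continuous_on UNIV f"
  by (auto dest: smooth_imp_C_k[where k = 0])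

lemma smooth_antiderivative:
  assumes "\<And>x. (F has_real_derivative f x) (at x)" "smooth f"
  shows "smooth F"
  unfolding smooth_def
proof
  fix k
  have "C_k (Suc k) F" using assms by (auto intro: C_k_SucI smooth_imp_C_k)
  then show "C_k k F" by (rule C_k_SucD)
qed

lemma smooth_exp: "smooth exp"
proof -
  have "C_k k (exp :: real \<Rightarrow> real)" for k
    by (induction k) (auto intro: C_k_SucI DERIV_exp simp: continuous_on_exp continuous_on_id)
  then show ?thesis by (simp add: smooth_def)
qed

lemma smooth_sin_cos: "smooth sin" "smooth cos"
proof -
  have "C_k k (sin :: real \<Rightarrow> real) \<and> C_k k (cos :: real \<Rightarrow> real)" for k
  proof (induction k)
    case 0
    show ?case by (simp add: continuous_on_sin continuous_on_cos continuous_on_id)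
  next
    case (Suc k)
    have "C_k k (\<lambda>x::real. - 1 * sin x)" using Suc by (intro C_k_mult C_k_const) auto
    moreover have "(cos has_real_derivative - 1 * sin x) (at x)" for x :: real
      by (auto intro!: derivative_eq_intros)
    ultimately have "C_k (Suc k) (cos :: real \<Rightarrow> real)" by (rule C_k_SucI[rotated])
    moreover have "C_k (Suc k) (sin :: real \<Rightarrow> real)"
      using Suc by (intro C_k_SucI[where f' = cos] DERIV_sin) auto
    ultimately show ?case by simp
  qed
  then show "smooth sin" "smooth cos" by (simp_all add: smooth_def)
qed

section \<open>Inverse functions and lifts of circle diffeomorphisms\<close>

lemma DERIV_inverse_function_UNIV:
  fixes \<psi> \<phi> :: "real \<Rightarrow> real"
  assumes d: "\<And>y. (\<psi> has_real_derivative \<psi>' y) (at y)" and nz: "\<And>y. \<psi>' y \<noteq> 0"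
    and l: "\<And>y. \<phi> (\<psi> y) = y" and r: "\<And>x. \<psi> (\<phi> x) = x"
  shows "(\<phi> has_real_derivative inverse (\<psi>' (\<phi> x))) (at x)"
proof -
  have "isCont \<phi> (\<psi> (\<phi> x))"
    by (rule isCont_inverse_function[of 1]) (simp_all add: l DERIV_isCont[OF d])
  then have "isCont \<phi> x" by (simp only: r)
  then show ?thesis
    by (intro DERIV_inverse_function[where f = \<psi> and a = "x - 1" and b = "x + 1"])
      (simp_all add: d nz r)
qed

text \<open>A bootstrap: the derivative of \<open>\<phi>\<close> is the reciprocal of
  \<open>deriv \<psi>\<close> at \<open>\<phi>\<close>, so it is as regular as \<open>\<phi>\<close>
  itself, and each round gains one derivative.\<close>

lemma smooth_inverse_function:
  assumes sm: "smooth \<psi>" and nz: "\<And>y. deriv \<psi> y \<noteq> 0"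
    and l: "\<And>y. \<phi> (\<psi> y) = y" and r: "\<And>x. \<psi> (\<phi> x) = x"
  shows "smooth \<phi>"
proof -
  have D: "(\<phi> has_real_derivative inverse (deriv \<psi> (\<phi> x))) (at x)" for x
    using smooth_has_deriv[OF sm] nz l r by (rule DERIV_inverse_function_UNIV)
  have "C_k k \<phi>" for k
  proof (induction k)
    case 0
    show ?case by (simp add: continuous_on_eq_continuous_at DERIV_isCont[OF D])
  next
    case (Suc k)
    have "C_k k (\<lambda>x. deriv \<psi> (\<phi> x))"
      using smooth_imp_C_k[OF smooth_deriv[OF sm]] Suc by (rule C_k_compose)
    then have "C_k k (\<lambda>x. inverse (deriv \<psi> (\<phi> x)))" by (rule C_k_inverse) (rule nz)
    then show ?case by (rule C_k_SucI[OF D])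
  qed
  then show ?thesis by (simp add: smooth_def)
qed

text \<open>Commuting with the shift by \<open>2 * pi\<close> makes \<open>\<psi>\<close> unbounded
  in both directions, so being increasing and continuous it is a bijection of the line. Its inverse
  commutes with the shifts too and hence descends to the circle.\<close>

lemma circle_diffeomorphism_inverse:
  assumes sm: "smooth \<psi>" and pos: "\<And>y. deriv \<psi> y > 0"
    and per: "\<And>y. \<psi> (y + 2 * pi) = \<psi> y + 2 * pi"
  obtains \<phi> where "circle_diffeomorphism \<phi>" "orientation_preserving \<phi>"
    "\<And>y. \<phi> (\<psi> y) = y" "\<And>x. \<psi> (\<phi> x) = x"
proof -
  have D: "(\<psi> has_real_derivative deriv \<psi> y) (at y)" for y
    by (rule smooth_has_deriv[OF sm])
  have mono: "\<psi> x < \<psi> y" if "x < y" for x y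
    by (rule DERIV_pos_imp_increasing[OF that]) (use D pos in blast)
  then have inj: "inj \<psi>" by (auto intro: strict_mono_imp_inj_on strict_monoI)
  have pern: "\<psi> (y + real n * (2 * pi)) = \<psi> y + real n * (2 * pi)" for y n
  proof (induction n)
    case (Suc n)
    have "\<psi> (y + real (Suc n) * (2 * pi)) = \<psi> ((y + real n * (2 * pi)) + 2 * pi)"
      by (simp add: algebra_simps)
    also have "\<dots> = \<psi> y + real n * (2 * pi) + 2 * pi" by (simp only: per Suc)
    finally show ?case by (simp add: algebra_simps)
  qed simp
  \<comment> \<open>For negative \<open>k\<close> the rule for naturals is applied at the shifted
    point, from which \<open>- k\<close> periods lead back to \<open>y\<close>.\<close>
  have peri: "\<psi> (y + of_int k * (2 * pi)) = \<psi> y + of_int k * (2 * pi)" for y k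
    using pern[of y "nat k"] pern[of "y + of_int k * (2 * pi)" "nat (- k)"]
    by (cases "k \<ge> 0") (auto simp: algebra_simps)
  have "\<exists>y. \<psi> y = x" for x
  proof -
    obtain k :: nat where "real k > \<bar>x - \<psi> 0\<bar>" using reals_Archimedean2 by blast
    moreover have "real k \<le> real k * (2 * pi)" using pi_gt3 by (simp add: mult_le_cancel_left1)
    ultimately have k: "real k * (2 * pi) > \<bar>x - \<psi> 0\<bar>" by linarith
    have "\<exists>y\<ge>- real k * (2 * pi). y \<le> real k * (2 * pi) \<and> \<psi> y = x"
    proof (rule IVT)
      show "\<psi> (- real k * (2 * pi)) \<le> x" "x \<le> \<psi> (real k * (2 * pi))"
        using k peri[of 0 "int k"] peri[of 0 "- int k"] by auto
      show "- real k * (2 * pi) \<le> real k * (2 * pi)" by simp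
    qed (simp add: DERIV_isCont[OF D])
    then show ?thesis by blast
  qed
  then have surj: "surj \<psi>" unfolding surj_def by metis
  define \<phi> where "\<phi> = inv \<psi>"
  have l: "\<phi> (\<psi> y) = y" for y
    unfolding \<phi>_def by (rule inv_f_f[OF inj])
  have r: "\<psi> (\<phi> x) = x" for x
    unfolding \<phi>_def by (rule surj_f_inv_f[OF surj])
  have nz: "deriv \<psi> y \<noteq> 0" for y using pos[of y] by simp
  have D\<phi>: "(\<phi> has_real_derivative inverse (deriv \<psi> (\<phi> x))) (at x)" for x
    using D nz l r by (rule DERIV_inverse_function_UNIV)
  have "smooth \<phi>"
    using sm nz l r by (rule smooth_inverse_function)
  moreover have "circle_eq (\<psi> x) (\<psi> y)" if "circle_eq x y" for x y
  proof -
    from that obtain k where "x - y = of_int k * (2 * pi)"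
      unfolding circle_eq_def by blast
    then have "x = y + of_int k * (2 * pi)" by linarith
    then show ?thesis using peri unfolding circle_eq_def by auto
  qed
  moreover have "circle_eq (\<phi> x) (\<phi> y)" if "circle_eq x y" for x y
  proof -
    from that obtain k where "x - y = of_int k * (2 * pi)"
      unfolding circle_eq_def by blast
    then have "x = y + of_int k * (2 * pi)" by linarith
    then have "x = \<psi> (\<phi> y + of_int k * (2 * pi))" by (simp add: peri r)
    then have "\<phi> x = \<phi> y + of_int k * (2 * pi)" by (simp add: l)
    then show ?thesis unfolding circle_eq_def by auto
  qed
  moreover have "circle_eq x x" for x unfolding circle_eq_def by (rule exI[of _ 0]) auto
  ultimately have "circle_diffeomorphism \<phi>"
    unfolding circle_diffeomorphism_def smooth_circle_map_def using sm
    by (intro conjI exI[of _ \<psi>]) (simp_all add: l r)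
  moreover have "orientation_preserving \<phi>"
    unfolding orientation_preserving_def
  proof
    show "deriv \<phi> x > 0" for x
      using DERIV_imp_deriv[OF D\<phi>[of x]] pos[of "\<phi> x"] by simp
  qed
  ultimately show thesis by (intro that[of \<phi>] l r)
qed

subsection \<open>Smoothed jumps\<close>

lemma cos_le_cos_away_from_0:
  assumes "0 \<le> \<delta>" "\<delta> \<le> z" "z \<le> 2 * pi - \<delta>"
  shows "cos z \<le> cos \<delta>"
proof (cases "z \<le> pi")
  case True
  then show ?thesis using assms by (intro cos_monotone_0_pi_le) auto
next
  case False
  have "cos (2 * pi - z) \<le> cos \<delta>" using assms False by (intro cos_monotone_0_pi_le) auto
  then show ?thesis by (simp add: cos_diff)
qed

lemma continuous_antiderivative:
  fixes f :: "real \<Rightarrow> real"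
  assumes "continuous_on UNIV f"
  obtains F where "\<And>x. (F has_real_derivative f x) (at x)"
proof -
  have "\<exists>F. \<forall>x. - \<infinity> < ereal x \<longrightarrow> ereal x < \<infinity> \<longrightarrow> (F has_vector_derivative f x) (at x)"
    using assms by (intro einterval_antiderivative) (auto simp: continuous_on_eq_continuous_at)
  then show thesis using that by (auto simp: has_real_derivative_iff_has_vector_derivative)
qed

text \<open>The derivative of \<open>E\<close> is exp(N (cos t - 1)) divided by its integral over a
  period: smooth, periodic, and concentrating at the multiples of \<open>2 * pi\<close> as N grows.
  It is positive everywhere, which makes the lifts built from it invertible with smooth inverse; a
  compactly supported bump would leave intervals where it vanishes.\<close>

lemma periodic_kernel:
  fixes \<delta> \<epsilon> :: real
  assumes "0 < \<delta>" "\<delta> < pi" "0 < \<epsilon>"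
  obtains E where "smooth E" "\<And>t. deriv E t > 0" "\<And>t. E (t + 2 * pi) = E t + 1"
    "E (2 * pi - \<delta>) - E \<delta> \<le> \<epsilon>"
proof -
  define c where "c = cos (\<delta> / 2) - cos \<delta>"
  have "c > 0" unfolding c_def using assms by (simp add: cos_monotone_0_pi)
  \<comment> \<open>The mass away from the peak is at most 2 pi exp(N (cos \<delta> - 1)), the whole
    mass \<open>J\<close> at least (\<delta>/2) exp(N (cos(\<delta>/2) - 1)). The quotient is at
    most (4 pi/\<delta>) exp(-N c), which this choice brings below \<open>\<epsilon>\<close>. The
    maximum with 0 covers a negative logarithm, as the bounds on \<open>e\<close> use
    \<open>N \<ge> 0\<close>.\<close>
  define N where "N = max 0 (ln (4 * pi / (\<delta> * \<epsilon>)) / c)"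
  have "N \<ge> 0" by (simp add: N_def)
  have "ln (4 * pi / (\<delta> * \<epsilon>)) / c \<le> N" by (simp add: N_def)
  then have Nc: "ln (4 * pi / (\<delta> * \<epsilon>)) \<le> N * c"
    using \<open>c > 0\<close> by (simp add: divide_le_eq)
  define e where "e = (\<lambda>t. exp (N * (cos t + - 1)))"
  have e_pos: "e t > 0" for t by (simp add: e_def)
  have sm_e: "smooth e"
    unfolding e_def
    by (intro smooth_compose[OF smooth_exp] smooth_mult smooth_add smooth_const smooth_sin_cos)
  obtain A where A: "\<And>t. (A has_real_derivative e t) (at t)"
    using continuous_antiderivative[OF smooth_imp_continuous[OF sm_e]] by blast
  have sm_A: "smooth A" by (rule smooth_antiderivative[OF A sm_e])
  have A_less: "A x < A y" if "x < y" for x y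
    by (rule DERIV_pos_imp_increasing[OF that]) (use A e_pos in blast)
  define J where "J = A (2 * pi) - A 0"
  have "J > 0" unfolding J_def using A_less[of 0 "2 * pi"] by simp
  have A_per: "A (t + 2 * pi) = A t + J" for t
  proof -
    have "((\<lambda>t. A (t + 2 * pi) - A t) has_real_derivative 0) (at t)" for t
    proof -
      have "((\<lambda>t. A (t + 2 * pi) - A t) has_real_derivative e (t + 2 * pi) * 1 - e t) (at t)"
        by (intro DERIV_diff A DERIV_chain2[where f = A and g = "\<lambda>t. t + 2 * pi"])
          (auto intro!: derivative_eq_intros)
      then show ?thesis by (simp add: e_def)
    qed
    then have "A (t + 2 * pi) - A t = A (0 + 2 * pi) - A 0"
      using DERIV_isconst_all[of "\<lambda>t. A (t + 2 * pi) - A t" t 0] by blast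
    then show ?thesis by (simp add: J_def)
  qed
  have lower: "\<delta> / 2 * exp (N * (cos (\<delta> / 2) - 1)) \<le> J"
  proof -
    obtain z where z: "0 < z" "z < \<delta> / 2" "A (\<delta> / 2) - A 0 = (\<delta> / 2 - 0) * e z"
      using MVT2[of 0 "\<delta> / 2" A e] A assms by auto
    have "cos (\<delta> / 2) \<le> cos z" using z assms by (intro cos_monotone_0_pi_le) auto
    then have "exp (N * (cos (\<delta> / 2) - 1)) \<le> e z"
      using \<open>N \<ge> 0\<close> by (simp add: e_def mult_left_mono)
    then have "\<delta> / 2 * exp (N * (cos (\<delta> / 2) - 1)) \<le> A (\<delta> / 2) - A 0"
      using z assms by simp
    also have "\<dots> \<le> J" unfolding J_def using A_less[of "\<delta> / 2" "2 * pi"] assms by simp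
    finally show ?thesis .
  qed
  have upper: "A (2 * pi - \<delta>) - A \<delta> \<le> 2 * pi * exp (N * (cos \<delta> - 1))"
  proof -
    obtain z where z: "\<delta> < z" "z < 2 * pi - \<delta>"
      "A (2 * pi - \<delta>) - A \<delta> = (2 * pi - \<delta> - \<delta>) * e z"
      using MVT2[of \<delta> "2 * pi - \<delta>" A e] A assms by auto
    have "cos z \<le> cos \<delta>" using z assms by (intro cos_le_cos_away_from_0) auto
    then have "e z \<le> exp (N * (cos \<delta> - 1))"
      using \<open>N \<ge> 0\<close> by (simp add: e_def mult_left_mono)
    then have "(2 * pi - \<delta> - \<delta>) * e z \<le> 2 * pi * exp (N * (cos \<delta> - 1))"
      using assms e_pos[of z] by (intro mult_mono) auto
    then show ?thesis using z by simp
  qed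
  have "2 * pi * exp (N * (cos \<delta> - 1)) \<le> \<epsilon> * (\<delta> / 2 * exp (N * (cos (\<delta> / 2) - 1)))"
  proof -
    have "4 * pi / (\<delta> * \<epsilon>) \<le> exp (N * c)"
      using Nc assms by (subst (asm) exp_le_cancel_iff[symmetric]) simp
    then have "2 * pi \<le> \<epsilon> * (\<delta> / 2) * exp (N * c)"
      using assms by (simp add: field_simps)
    then have "2 * pi * exp (N * (cos \<delta> - 1)) \<le> \<epsilon> * (\<delta> / 2) * exp (N * c) * exp (N * (cos \<delta> - 1))"
      by (intro mult_right_mono) auto
    also have "\<dots> = \<epsilon> * (\<delta> / 2 * exp (N * c + N * (cos \<delta> - 1)))"
      by (simp only: exp_add mult.assoc)
    also have "N * c + N * (cos \<delta> - 1) = N * (cos (\<delta> / 2) - 1)"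
      by (simp add: c_def algebra_simps)
    finally show ?thesis .
  qed
  also have "\<dots> \<le> \<epsilon> * J" using lower assms by (intro mult_left_mono) auto
  finally have small: "A (2 * pi - \<delta>) - A \<delta> \<le> \<epsilon> * J" using upper by linarith
  show thesis
  proof (rule that[of "\<lambda>t. inverse J * A t"])
    show "smooth (\<lambda>t. inverse J * A t)" by (intro smooth_mult smooth_const sm_A)
    have "((\<lambda>t. inverse J * A t) has_real_derivative inverse J * e t) (at t)" for t
      by (intro DERIV_cmult A)
    then have "deriv (\<lambda>t. inverse J * A t) t = inverse J * e t" for t
      by (rule DERIV_imp_deriv)
    then show "deriv (\<lambda>t. inverse J * A t) t > 0" for t using e_pos \<open>J > 0\<close> by simp
    show "inverse J * A (t + 2 * pi) = inverse J * A t + 1" for t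
      using \<open>J > 0\<close> unfolding A_per by (simp add: field_simps)
    show "inverse J * A (2 * pi - \<delta>) - inverse J * A \<delta> \<le> \<epsilon>"
      using small \<open>J > 0\<close> by (simp add: field_simps)
  qed
qed

text \<open>If \<open>f\<close> were constantly \<open>v\<close>, the integrand would be
  \<open>v\<close> times the derivative of \<open>G \<circ> \<psi>\<close> and the integral exact.
  The deviation is charged to \<open>\<psi> b - \<psi> a\<close> and not to \<open>b - a\<close>, so
  the bound survives arbitrarily steep \<open>\<psi>\<close>.\<close>

lemma integral_pullback_approx:
  fixes f g \<psi> :: "real \<Rightarrow> real"
  assumes "a \<le> b"
    and f: "continuous_on UNIV f" and g: "continuous_on UNIV g" and \<psi>': "continuous_on UNIV \<psi>'"
    and D\<psi>: "\<And>y. (\<psi> has_real_derivative \<psi>' y) (at y)" and pos: "\<And>y. \<psi>' y \<ge> 0"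
    and DG: "\<And>y. (G has_real_derivative g y) (at y)"
    and gB: "\<And>y. \<bar>g y\<bar> \<le> B" and near: "\<And>y. y \<in> {a..b} \<Longrightarrow> \<bar>f y - v\<bar> \<le> e"
  shows "\<bar>integral {a..b} (\<lambda>y. f y * (g (\<psi> y) * \<psi>' y)) - v * (G (\<psi> b) - G (\<psi> a))\<bar>
    \<le> e * B * (\<psi> b - \<psi> a)"
proof -
  have cont\<psi>: "continuous_on UNIV \<psi>"
    using D\<psi> by (intro DERIV_continuous_on) (auto intro: has_field_derivative_at_within)
  have cg: "continuous_on UNIV (\<lambda>y. g (\<psi> y))"
    using continuous_on_compose2[OF g cont\<psi>] by simp
  have int: "h integrable_on {a..b}" if "continuous_on UNIV h" for h :: "real \<Rightarrow> real"
    using that by (intro integrable_continuous_interval) (rule continuous_on_subset, auto)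
  have i1: "(\<lambda>y. f y * (g (\<psi> y) * \<psi>' y)) integrable_on {a..b}"
    by (intro int continuous_on_mult f cg \<psi>')
  have DG\<psi>: "((\<lambda>y. G (\<psi> y)) has_real_derivative g (\<psi> y) * \<psi>' y) (at y)" for y
    by (rule DERIV_chain2[OF DG D\<psi>])
  have i2: "((\<lambda>y. g (\<psi> y) * \<psi>' y) has_integral G (\<psi> b) - G (\<psi> a)) {a..b}"
    using \<open>a \<le> b\<close> DG\<psi>
    by (intro fundamental_theorem_of_calculus)
      (auto simp: has_real_derivative_iff_has_vector_derivative[symmetric]
        intro: has_field_derivative_at_within)
  have i3: "(\<psi>' has_integral \<psi> b - \<psi> a) {a..b}"
    using \<open>a \<le> b\<close> D\<psi>
    by (intro fundamental_theorem_of_calculus)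
      (auto simp: has_real_derivative_iff_has_vector_derivative[symmetric]
        intro: has_field_derivative_at_within)
  have h1: "((\<lambda>y. f y * (g (\<psi> y) * \<psi>' y) - v * (g (\<psi> y) * \<psi>' y)) has_integral
      integral {a..b} (\<lambda>y. f y * (g (\<psi> y) * \<psi>' y)) - v * (G (\<psi> b) - G (\<psi> a))) {a..b}"
    by (intro has_integral_diff has_integral_mult_right integrable_integral i1 i2)
  have h2: "((\<lambda>y. e * B * \<psi>' y) has_integral e * B * (\<psi> b - \<psi> a)) {a..b}"
    by (intro has_integral_mult_right i3)
  have "norm (f y * (g (\<psi> y) * \<psi>' y) - v * (g (\<psi> y) * \<psi>' y)) \<le> e * B * \<psi>' y"
    if "y \<in> {a..b}" for y
  proof -
    have "norm (f y * (g (\<psi> y) * \<psi>' y) - v * (g (\<psi> y) * \<psi>' y)) = \<bar>f y - v\<bar> * \<bar>g (\<psi> y)\<bar> * \<psi>' y"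
      using pos[of y] by (simp add: left_diff_distrib[symmetric] abs_mult mult.assoc)
    also have "\<dots> \<le> e * B * \<psi>' y"
      using near[OF that] gB[of "\<psi> y"] pos[of y] by (intro mult_right_mono mult_mono) auto
    finally show ?thesis .
  qed
  from integral_norm_bound_integral[OF has_integral_integrable[OF h1] has_integral_integrable[OF h2] this]
  show ?thesis unfolding integral_unique[OF h1] integral_unique[OF h2] by simp
qed

section \<open>Lifts with prescribed jumps near prescribed points\<close>

lemma abs_increment_le:
  fixes G :: "real \<Rightarrow> real"
  assumes DG: "\<And>y. (G has_real_derivative g y) (at y)" and gB: "\<And>y. \<bar>g y\<bar> \<le> B"
  shows "\<bar>G b - G a\<bar> \<le> B * \<bar>b - a\<bar>"
proof -
  have "norm (G b - G a) \<le> B * norm (b - a)"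
    by (rule field_differentiable_bound[of UNIV G g B])
      (use DG gB in auto)
  then show ?thesis by simp
qed

text \<open>
  \<open>H k\<close> is a smoothed Heaviside function jumping at \<open>c k\<close>, so the lift with derivative
  \<open>\<Sum>k<K. m k * deriv (H k) y\<close> spends time \<open>m k\<close> near \<open>c k\<close>; the condition is uniform in the masses.
\<close>

definition approximates_jumps ::
  "(real \<Rightarrow> real) \<Rightarrow> (nat \<Rightarrow> real) \<Rightarrow> real \<Rightarrow> nat \<Rightarrow> real \<Rightarrow> real \<Rightarrow> (nat \<Rightarrow> real \<Rightarrow> real) \<Rightarrow> bool"
  where "approximates_jumps f c a K B \<epsilon> H \<longleftrightarrow>
    (\<forall>m g G. (\<forall>k<K. m k \<ge> 0) \<longrightarrow> (\<Sum>k<K. m k) = 2 * pi \<longrightarrow> continuous_on UNIV g \<longrightarrow>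
      (\<forall>y. \<bar>g y\<bar> \<le> B) \<longrightarrow> (\<forall>y. (G has_real_derivative g y) (at y)) \<longrightarrow>
      \<bar>integral {a..a + 2 * pi}
          (\<lambda>y. f y * (g (\<Sum>k<K. m k * H k y) * (\<Sum>k<K. m k * deriv (H k) y)))
        - (\<Sum>k<K. f (c k) * (G (\<Sum>l<Suc k. m l) - G (\<Sum>l<k. m l)))\<bar> \<le> \<epsilon>)"

text \<open>Each cell from \<open>d k\<close> to \<open>d (Suc k)\<close> is cut at
  \<open>c k - \<rho>\<close> and \<open>c k + \<rho>\<close>. In the middle \<open>f\<close> is
  within \<open>e1\<close> of \<open>f (c k)\<close>; on the two sides \<open>f\<close> is only
  bounded, but there every \<open>H l\<close> rises by at most \<open>e2\<close>. Nonnegative masses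
  enter the bounds only through their sum, whence the uniformity.\<close>

lemma smoothed_jumps:
  fixes f :: "real \<Rightarrow> real" and c d :: "nat \<Rightarrow> real" and K :: nat
  assumes f: "continuous_on UNIV f"
    and cd: "\<And>k. k < K \<Longrightarrow> d k < c k \<and> c k < d (Suc k)" and dK: "d K = d 0 + 2 * pi"
    and "K > 0" "\<epsilon> > 0" "B \<ge> 0"
  obtains H :: "nat \<Rightarrow> real \<Rightarrow> real" where
    "\<And>k. smooth (H k)" "\<And>k y. deriv (H k) y > 0" "\<And>k. H k (d 0) = 0"
    "\<And>k y. H k (y + 2 * pi) = H k y + 1"
    "approximates_jumps f c (d 0) K B \<epsilon> H"
proof -
  have d_mono: "d i \<le> d k" if "i \<le> k" "k \<le> K" for i k
    using that
  proof (induction k rule: dec_induct)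
    case (step k)
    then show ?case using cd[of k] by simp
  qed simp
  have "compact {d 0..d 0 + 2 * pi}" by simp
  then have "bounded (f ` {d 0..d 0 + 2 * pi})"
    using f by (intro compact_imp_bounded compact_continuous_image) (auto elim: continuous_on_subset)
  then obtain A where A: "\<And>y. y \<in> {d 0..d 0 + 2 * pi} \<Longrightarrow> \<bar>f y\<bar> \<le> A"
    unfolding bounded_iff by (metis imageI real_norm_def)
  have "A \<ge> 0" using A[of "d 0"] by auto
  \<comment> \<open>Makes the middle parts of all \<open>K\<close> cells cost at most \<epsilon>/2,
    as the lift gains at most \<open>2 * pi\<close> on each. The summand 1 keeps the denominator
    positive when \<open>B = 0\<close>.\<close>
  define e1 where "e1 = \<epsilon> / (2 * (2 * pi * B * K + 1))"
  have den: "2 * pi * B * K + 1 > 0"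
    using \<open>B \<ge> 0\<close> by (intro add_nonneg_pos mult_nonneg_nonneg) auto
  then have "e1 > 0" using \<open>\<epsilon> > 0\<close> by (simp add: e1_def)
  have e1: "K * (e1 * B * (2 * pi)) \<le> \<epsilon> / 2"
  proof -
    have "K * (e1 * B * (2 * pi)) = e1 * (2 * pi * B * K)" by (simp add: mult_ac)
    also have "\<dots> \<le> e1 * (2 * pi * B * K + 1)" using \<open>e1 > 0\<close> by (intro mult_left_mono) auto
    also have "\<dots> = \<epsilon> / 2" using den by (simp add: e1_def field_simps)
    finally show ?thesis .
  qed
  have "\<exists>r>0. r \<le> c k - d k \<and> r \<le> d (Suc k) - c k \<and> (\<forall>y. \<bar>y - c k\<bar> \<le> r \<longrightarrow> \<bar>f y - f (c k)\<bar> \<le> e1)"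
    if "k < K" for k
  proof -
    have "isCont f (c k)" using f by (simp add: continuous_on_eq_continuous_at)
    then obtain s where "s > 0" "\<And>y. \<bar>y - c k\<bar> < s \<Longrightarrow> \<bar>f y - f (c k)\<bar> < e1"
      using \<open>e1 > 0\<close> unfolding continuous_at_eps_delta dist_real_def by blast
    then show ?thesis using cd[OF that]
      by (intro exI[of _ "min (s / 2) (min (c k - d k) (d (Suc k) - c k))"])
        (auto simp: min_def less_imp_le)
  qed
  then obtain r where r: "\<And>k. k < K \<Longrightarrow> r k > 0 \<and> r k \<le> c k - d k \<and> r k \<le> d (Suc k) - c k \<and>
      (\<forall>y. \<bar>y - c k\<bar> \<le> r k \<longrightarrow> \<bar>f y - f (c k)\<bar> \<le> e1)" by metis
  \<comment> \<open>The bound 1 guarantees \<open>\<rho> < pi\<close>, as the kernel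
    requires.\<close>
  define \<rho> where "\<rho> = min 1 (Min (r ` {..<K}))"
  have "Min (r ` {..<K}) > 0"
    using r \<open>K > 0\<close> by (subst Min_gr_iff) (auto simp: lessThan_empty_iff)
  then have "\<rho> > 0" by (simp add: \<rho>_def)
  have "\<rho> \<le> 1" by (simp add: \<rho>_def)
  then have "\<rho> < pi" using pi_gt3 by linarith
  have \<rho>_r: "\<rho> \<le> r k" if "k < K" for k
    using that by (simp add: \<rho>_def min.coboundedI2)
  have \<rho>: "\<rho> \<le> c k - d k" "\<rho> \<le> d (Suc k) - c k" if "k < K" for k
    using r[OF that] \<rho>_r[OF that] by linarith+
  have f_near: "\<bar>f y - f (c k)\<bar> \<le> e1" if "k < K" "\<bar>y - c k\<bar> \<le> \<rho>" for k y
    using r[OF that(1)] \<rho>_r[OF that(1)] that(2) by simp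
  \<comment> \<open>The 12 collects three errors of 4 A B pi e2 per cell: the left part, the right
    part, and the shift of the endpoints \<open>\<psi> (d k)\<close> away from the exact partial
    sums of the masses.\<close>
  define e2 where "e2 = \<epsilon> / (2 * (12 * A * B * pi * K + 1))"
  have den2: "12 * A * B * pi * K + 1 > 0"
    using \<open>B \<ge> 0\<close> \<open>A \<ge> 0\<close> by (intro add_nonneg_pos mult_nonneg_nonneg) auto
  then have "e2 > 0" using \<open>\<epsilon> > 0\<close> by (simp add: e2_def)
  have e2: "K * (12 * A * B * pi * e2) \<le> \<epsilon> / 2"
  proof -
    have "K * (12 * A * B * pi * e2) = e2 * (12 * A * B * pi * K)" by (simp add: mult_ac)
    also have "\<dots> \<le> e2 * (12 * A * B * pi * K + 1)" using \<open>e2 > 0\<close> by (intro mult_left_mono) auto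
    also have "\<dots> = \<epsilon> / 2" using den2 by (simp add: e2_def field_simps)
    finally show ?thesis .
  qed
  obtain E where E: "smooth E" "\<And>t. deriv E t > 0" "\<And>t. E (t + 2 * pi) = E t + 1"
    "E (2 * pi - \<rho>) - E \<rho> \<le> e2"
    using periodic_kernel[OF \<open>\<rho> > 0\<close> \<open>\<rho> < pi\<close> \<open>e2 > 0\<close>] by blast
  have DE: "(E has_real_derivative deriv E t) (at t)" for t by (rule smooth_has_deriv[OF E(1)])
  have E_mono: "E s \<le> E t" if "s \<le> t" for s t
    by (rule DERIV_nonneg_imp_nondecreasing[OF that]) (use DE E(2) less_imp_le in blast)
  \<comment> \<open>The stretch between two consecutive peaks, moved by one period onto the interval
    for which the bound on \<open>E\<close> is known.\<close>
  have E_gap: "E t - E s \<le> e2" if "s \<le> t" "\<rho> - 2 * pi \<le> s" "t \<le> - \<rho>" for s t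
  proof -
    have "E t - E s \<le> E (- \<rho>) - E (\<rho> - 2 * pi)" using E_mono that by (intro diff_mono) auto
    also have "\<dots> = E (2 * pi - \<rho>) - E \<rho>" using E(3)[of "- \<rho>"] E(3)[of "\<rho> - 2 * pi"] by simp
    finally show ?thesis using E(4) by linarith
  qed
  \<comment> \<open>The subtracted constant makes \<open>H k\<close> vanish at \<open>d 0\<close>.
    Of its jumps, at \<open>c k\<close> plus multiples of \<open>2 * pi\<close>, only the one at
    \<open>c k\<close> lies in the period starting at \<open>d 0\<close>.\<close>
  define H where "H k y = E (y - c k) - E (d 0 - c k)" for k y
  have DH: "(H k has_real_derivative deriv E (y - c k)) (at y)" for k y
    unfolding H_def
    by (rule DERIV_cong, rule DERIV_diff, rule DERIV_chain2[OF DE])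
      (auto intro!: derivative_eq_intros)
  have dH: "deriv (H k) y = deriv E (y - c k)" for k y by (rule DERIV_imp_deriv[OF DH])
  have smH: "smooth (H k)" for k
  proof -
    have "smooth (\<lambda>y. E (y + - c k) + - E (d 0 - c k))"
      by (intro smooth_add smooth_const smooth_compose[OF E(1)])
        (rule smooth_antiderivative[OF _ smooth_const[of 1]], auto intro!: derivative_eq_intros)
    then show ?thesis by (simp add: H_def[abs_def])
  qed
  have H0: "H k (d 0) = 0" for k by (simp add: H_def)
  have Hper: "H k (y + 2 * pi) = H k y + 1" for k y
    using E(3)[of "y - c k"] by (simp add: H_def add_diff_eq algebra_simps)
  have H_mono: "H k x \<le> H k y" if "x \<le> y" for k x y
    using E_mono[of "x - c k" "y - c k"] that by (simp add: H_def)
  have range: "d 0 + \<rho> \<le> c k" "c k \<le> d 0 + 2 * pi - \<rho>" if "k < K" for k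
    using \<rho>[OF that] d_mono[of 0 k] d_mono[of "Suc k" K] dK that by auto
  have H_left: "H k y - H k x \<le> e2" if "k < K" "d 0 \<le> x" "x \<le> y" "y \<le> c k - \<rho>" for k x y
    using E_gap[of "x - c k" "y - c k"] range[OF that(1)] that by (simp add: H_def)
  have H_right: "H k y - H k x \<le> e2" if "k < K" "c k + \<rho> \<le> x" "x \<le> y" "y \<le> d 0 + 2 * pi" for k x y
  proof -
    have "E (y - c k) - E (x - c k) = E (y - c k - 2 * pi) - E (x - c k - 2 * pi)"
      using E(3)[of "y - c k - 2 * pi"] E(3)[of "x - c k - 2 * pi"] by simp
    also have "\<dots> \<le> e2" using range[OF that(1)] that by (intro E_gap) auto
    finally show ?thesis by (simp add: H_def)
  qed
  have main: "\<bar>integral {d 0..d 0 + 2 * pi}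
          (\<lambda>y. f y * (g (\<Sum>k<K. m k * H k y) * (\<Sum>k<K. m k * deriv (H k) y)))
        - (\<Sum>k<K. f (c k) * (G (\<Sum>l<Suc k. m l) - G (\<Sum>l<k. m l)))\<bar> \<le> \<epsilon>"
    if m: "\<And>k. k < K \<Longrightarrow> m k \<ge> 0" "(\<Sum>k<K. m k) = 2 * pi" and g: "continuous_on UNIV g"
      and gB: "\<And>y. \<bar>g y\<bar> \<le> B" and DG: "\<And>y. (G has_real_derivative g y) (at y)" for m g G
  proof -
    define \<psi> where "\<psi> y = (\<Sum>k<K. m k * H k y)" for y
    define \<psi>' where "\<psi>' y = (\<Sum>k<K. m k * deriv (H k) y)" for y
    have D\<psi>: "(\<psi> has_real_derivative \<psi>' y) (at y)" for y
      unfolding \<psi>_def[abs_def] \<psi>'_def using smooth_has_deriv[OF smH]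
      by (intro DERIV_sum DERIV_cmult)
    have \<psi>'_nonneg: "\<psi>' y \<ge> 0" for y
      unfolding \<psi>'_def using m E(2) by (intro sum_nonneg mult_nonneg_nonneg) (auto simp: dH less_imp_le)
    have cont\<psi>': "continuous_on UNIV \<psi>'"
      unfolding \<psi>'_def[abs_def]
      using smooth_imp_continuous[OF smooth_deriv[OF smH]] by (intro continuous_intros)
    have \<psi>_mono: "\<psi> x \<le> \<psi> y" if "x \<le> y" for x y
      unfolding \<psi>_def using H_mono[OF that] m by (intro sum_mono mult_left_mono) auto
    have \<psi>_diff: "\<psi> y - \<psi> x \<le> 2 * pi * e2" if "\<And>k. k < K \<Longrightarrow> H k y - H k x \<le> e2" for x y
    proof -
      have "\<psi> y - \<psi> x = (\<Sum>k<K. m k * (H k y - H k x))"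
        by (simp add: \<psi>_def sum_subtractf right_diff_distrib)
      also have "\<dots> \<le> (\<Sum>k<K. m k * e2)" using that m by (intro sum_mono mult_left_mono) auto
      also have "\<dots> = 2 * pi * e2" using m by (simp flip: sum_distrib_right)
      finally show ?thesis .
    qed
    \<comment> \<open>At the cell boundary \<open>d j\<close> the jumps with index below
      \<open>j\<close> are all but complete and the others have hardly begun, so each
      \<open>H k\<close> is compared with 1 or 0.\<close>
    have \<psi>_d: "\<bar>\<psi> (d j) - (\<Sum>l<j. m l)\<bar> \<le> 2 * pi * e2" if "j \<le> K" for j
    proof -
      have "(\<Sum>l<j. m l) = (\<Sum>k<K. m k * (if k < j then 1 else 0))"
        using that by (subst sum.mono_neutral_cong_right[of "{..<K}" "{..<j}"]) auto
      then have "\<psi> (d j) - (\<Sum>l<j. m l) = (\<Sum>k<K. m k * (H k (d j) - (if k < j then 1 else 0)))"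
        by (simp add: \<psi>_def sum_subtractf right_diff_distrib)
      also have "\<bar>\<dots>\<bar> \<le> (\<Sum>k<K. m k * e2)"
      proof (rule order_trans[OF sum_abs], rule sum_mono)
        fix k assume "k \<in> {..<K}"
        then have k: "k < K" by simp
        have dj: "d 0 \<le> d j" "d j \<le> d 0 + 2 * pi" using d_mono[of 0 j] d_mono[of j K] that dK by auto
        have "\<bar>H k (d j) - (if k < j then 1 else 0)\<bar> \<le> e2"
        proof (cases "k < j")
          case True
          then have "c k + \<rho> \<le> d j" using d_mono[of "Suc k" j] \<rho>[OF k] that by simp
          then show ?thesis
            using H_right[OF k _ dj(2)] H_mono[OF dj(2), of k] Hper[of k "d 0"] H0[of k] True by simp
        next
          case False
          then have "d j \<le> c k - \<rho>" using d_mono[of j k] \<rho>[OF k] k by simp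
          then show ?thesis using H_left[OF k _ dj(1)] H_mono[OF dj(1), of k] H0[of k] False by simp
        qed
        then show "\<bar>m k * (H k (d j) - (if k < j then 1 else 0))\<bar> \<le> m k * e2"
          using m(1)[OF k] by (simp add: abs_mult mult_left_mono)
      qed
      also have "\<dots> = 2 * pi * e2" using m by (simp flip: sum_distrib_right)
      finally show ?thesis .
    qed
    define I where "I a b = integral {a..b} (\<lambda>y. f y * (g (\<psi> y) * \<psi>' y))" for a b
    have cont\<psi>: "continuous_on UNIV \<psi>"
      using D\<psi> by (intro DERIV_continuous_on) (auto intro: has_field_derivative_at_within)
    have contF: "continuous_on UNIV (\<lambda>y. f y * (g (\<psi> y) * \<psi>' y))"
      using continuous_on_compose2[OF g cont\<psi>] by (intro continuous_on_mult f cont\<psi>') auto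
    have I_comb: "I a b + I b e = I a e" if "a \<le> b" "b \<le> e" for a b e
      unfolding I_def using that contF
      by (intro Henstock_Kurzweil_Integration.integral_combine integrable_continuous_interval)
        (auto elim: continuous_on_subset)
    have I_sum: "I (d 0) (d j) = (\<Sum>k<j. I (d k) (d (Suc k)))" if "j \<le> K" for j
      using that
    proof (induction j)
      case (Suc j)
      then show ?case using I_comb[of "d 0" "d j" "d (Suc j)"] d_mono[of 0 j] d_mono[of j "Suc j"] by simp
    qed (simp add: I_def)
    have I_bound: "\<bar>I a b - v * (G (\<psi> b) - G (\<psi> a))\<bar> \<le> e * B * (\<psi> b - \<psi> a)"
      if "a \<le> b" "\<And>y. y \<in> {a..b} \<Longrightarrow> \<bar>f y - v\<bar> \<le> e" for a b v e
      unfolding I_def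
      using integral_pullback_approx[OF that(1) f g cont\<psi>' D\<psi> \<psi>'_nonneg DG gB that(2)] by simp
    have piece: "\<bar>I (d k) (d (Suc k)) - f (c k) * (G (\<Sum>l<Suc k. m l) - G (\<Sum>l<k. m l))\<bar>
        \<le> e1 * B * (2 * pi) + 12 * A * B * pi * e2" if k: "k < K" for k
    proof -
      let ?a = "d k" and ?p = "c k - \<rho>" and ?q = "c k + \<rho>" and ?b = "d (Suc k)"
      have ord: "?a \<le> ?p" "?p \<le> ?q" "?q \<le> ?b" using \<rho>[OF k] \<open>\<rho> > 0\<close> by auto
      have dk: "d 0 \<le> ?a" "?b \<le> d 0 + 2 * pi"
        using d_mono[of 0 k] d_mono[of "Suc k" K] k dK by auto
      have far: "\<bar>f y - f (c k)\<bar> \<le> 2 * A" if "y \<in> {d 0..d 0 + 2 * pi}" for y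
        using A[OF that] A[of "c k"] range[OF k] \<open>\<rho> > 0\<close> by auto
      have gapL: "\<psi> ?p - \<psi> ?a \<le> 2 * pi * e2"
      proof (rule \<psi>_diff)
        fix l assume l: "l < K"
        show "H l ?p - H l ?a \<le> e2"
        proof (cases "l < k")
          case True
          then show ?thesis
            using H_right[OF l, of ?a ?p] d_mono[of "Suc l" k] \<rho>[OF l] ord dk k by simp
        next
          case False
          then have "c k \<le> c l" using d_mono[of "Suc k" l] \<rho>[OF l] \<rho>[OF k] \<open>\<rho> > 0\<close> l
            by (cases "l = k") auto
          then show ?thesis using H_left[OF l, of ?a ?p] ord dk by simp
        qed
      qed
      have gapR: "\<psi> ?b - \<psi> ?q \<le> 2 * pi * e2"
      proof (rule \<psi>_diff)
        fix l assume l: "l < K"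
        show "H l ?b - H l ?q \<le> e2"
        proof (cases "l \<le> k")
          case True
          then have "c l \<le> c k" using d_mono[of "Suc l" k] \<rho>[OF l] \<rho>[OF k] \<open>\<rho> > 0\<close> k
            by (cases "l = k") auto
          then show ?thesis using H_right[OF l, of ?q ?b] ord dk by simp
        next
          case False
          then show ?thesis
            using H_left[OF l, of ?q ?b] d_mono[of "Suc k" l] \<rho>[OF l] ord dk l by simp
        qed
      qed
      have "\<bar>I ?a ?p - f (c k) * (G (\<psi> ?p) - G (\<psi> ?a))\<bar> \<le> 2 * A * B * (\<psi> ?p - \<psi> ?a)"
        using ord dk by (intro I_bound far) auto
      also have "\<dots> \<le> 2 * A * B * (2 * pi * e2)"
        using gapL \<open>A \<ge> 0\<close> \<open>B \<ge> 0\<close> by (intro mult_left_mono) auto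
      finally have 1: "\<bar>I ?a ?p - f (c k) * (G (\<psi> ?p) - G (\<psi> ?a))\<bar> \<le> 4 * A * B * pi * e2"
        by (simp add: mult_ac)
      have "\<bar>I ?q ?b - f (c k) * (G (\<psi> ?b) - G (\<psi> ?q))\<bar> \<le> 2 * A * B * (\<psi> ?b - \<psi> ?q)"
        using ord dk by (intro I_bound far) auto
      also have "\<dots> \<le> 2 * A * B * (2 * pi * e2)"
        using gapR \<open>A \<ge> 0\<close> \<open>B \<ge> 0\<close> by (intro mult_left_mono) auto
      finally have 2: "\<bar>I ?q ?b - f (c k) * (G (\<psi> ?b) - G (\<psi> ?q))\<bar> \<le> 4 * A * B * pi * e2"
        by (simp add: mult_ac)
      have "\<psi> ?q - \<psi> ?p \<le> \<psi> (d 0 + 2 * pi) - \<psi> (d 0)"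
        using ord dk by (intro diff_mono \<psi>_mono) auto
      also have "\<dots> = 2 * pi" using m(2) by (simp add: \<psi>_def Hper H0 distrib_left)
      finally have "\<psi> ?q - \<psi> ?p \<le> 2 * pi" .
      then have "e1 * B * (\<psi> ?q - \<psi> ?p) \<le> e1 * B * (2 * pi)"
        using \<open>e1 > 0\<close> \<open>B \<ge> 0\<close> by (intro mult_left_mono) auto
      moreover have "\<bar>I ?p ?q - f (c k) * (G (\<psi> ?q) - G (\<psi> ?p))\<bar> \<le> e1 * B * (\<psi> ?q - \<psi> ?p)"
        using ord by (intro I_bound f_near[OF k]) auto
      ultimately have 3: "\<bar>I ?p ?q - f (c k) * (G (\<psi> ?q) - G (\<psi> ?p))\<bar> \<le> e1 * B * (2 * pi)"
        by linarith
      have 4: "\<bar>G (\<psi> (d j)) - G (\<Sum>l<j. m l)\<bar> \<le> B * (2 * pi * e2)" if "j \<le> K" for j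
        using abs_increment_le[OF DG gB, of "\<psi> (d j)" "\<Sum>l<j. m l"]
          mult_left_mono[OF \<psi>_d[OF that] \<open>B \<ge> 0\<close>] by linarith
      \<comment> \<open>The three parts telescope to the increment of \<open>G\<close> between the
        true endpoints \<open>\<psi> (d k)\<close> and \<open>\<psi> (d (Suc k))\<close>;
        \<open>D\<close> corrects these to the partial sums of the masses.\<close>
      define D where "D = G (\<psi> ?b) - G (\<psi> ?a) - (G (\<Sum>l<Suc k. m l) - G (\<Sum>l<k. m l))"
      have "\<bar>D\<bar> \<le> 4 * B * pi * e2"
        using 4[of k] 4[of "Suc k"] k unfolding D_def by (simp add: mult_ac)
      then have 5: "\<bar>f (c k) * D\<bar> \<le> A * (4 * B * pi * e2)"
        unfolding abs_mult using A[of "c k"] range[OF k] \<open>\<rho> > 0\<close> \<open>A \<ge> 0\<close> by (intro mult_mono) auto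
      have I3: "I ?a ?b = I ?a ?p + I ?p ?q + I ?q ?b"
        using I_comb[of ?a ?p ?q] I_comb[of ?a ?q ?b] ord by simp
      have split: "I ?a ?b - f (c k) * (G (\<Sum>l<Suc k. m l) - G (\<Sum>l<k. m l)) =
        (I ?a ?p - f (c k) * (G (\<psi> ?p) - G (\<psi> ?a))) + (I ?p ?q - f (c k) * (G (\<psi> ?q) - G (\<psi> ?p)))
        + (I ?q ?b - f (c k) * (G (\<psi> ?b) - G (\<psi> ?q))) + f (c k) * D"
        unfolding I3 D_def by (simp only: algebra_simps)
      have "A * (4 * B * pi * e2) = 4 * A * B * pi * e2" by simp
      then show ?thesis unfolding split using 1 2 3 5 by linarith
    qed
    have "I (d 0) (d 0 + 2 * pi) = (\<Sum>k<K. I (d k) (d (Suc k)))" using I_sum[of K] dK by simp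
    then have "I (d 0) (d 0 + 2 * pi) - (\<Sum>k<K. f (c k) * (G (\<Sum>l<Suc k. m l) - G (\<Sum>l<k. m l)))
      = (\<Sum>k<K. I (d k) (d (Suc k)) - f (c k) * (G (\<Sum>l<Suc k. m l) - G (\<Sum>l<k. m l)))"
      by (simp only: sum_subtractf)
    also have "\<bar>\<dots>\<bar> \<le> (\<Sum>k<K. e1 * B * (2 * pi) + 12 * A * B * pi * e2)"
      by (rule order_trans[OF sum_abs], rule sum_mono) (use piece in simp)
    also have "\<dots> = K * (e1 * B * (2 * pi)) + K * (12 * A * B * pi * e2)"
      by (simp add: distrib_left)
    also have "\<dots> \<le> \<epsilon>" using e1 e2 by linarith
    finally show ?thesis unfolding I_def \<psi>_def \<psi>'_def .
  qed
  have "approximates_jumps f c (d 0) K B \<epsilon> H"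
    unfolding approximates_jumps_def by (intro allI impI main) auto
  then show thesis by (intro that[of H] smH H0 Hper) (simp_all add: dH E(2))
qed

subsection \<open>The Poincare-Miranda theorem\<close>

text \<open>Tychonoff. Points are functions on all naturals because the number \<open>n\<close> of
  unknowns is a variable and Kuhn's lemma uses this format.\<close>

lemma compact_cube_nat_fun: "compact {x :: nat \<Rightarrow> real. \<forall>i. x i \<in> {a..b}}"
proof -
  have "compactin (product_topology (\<lambda>i::nat. euclidean) UNIV) (PiE UNIV (\<lambda>i. {a..b::real}))"
    by (subst compactin_PiE) (auto simp: compactin_euclidean_iff)
  moreover have "PiE UNIV (\<lambda>i. {a..b}) = {x :: nat \<Rightarrow> real. \<forall>i. x i \<in> {a..b}}" by auto
  ultimately show ?thesis by (simp add: euclidean_product_topology compactin_euclidean_iff)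
qed

lemma tendsto_nat_fun:
  fixes x :: "nat \<Rightarrow> nat \<Rightarrow> real"
  shows "(x \<longlonglongrightarrow> l) \<longleftrightarrow> (\<forall>i. (\<lambda>k. x k i) \<longlonglongrightarrow> l i)"
  using limitin_componentwise[of "\<lambda>i::nat. euclidean :: real topology" UNIV x l sequentially]
  by (simp add: euclidean_product_topology)

text \<open>On the grid of mesh 1/p each vertex is labelled by the signs of the \<open>F i\<close>.
  Kuhn's lemma finds a cell in which every \<open>i\<close> has both labels, hence vertices with
  \<open>F i \<le> 0\<close> and with \<open>F i \<ge> 0\<close>. As p grows, the cells accumulate
  at a point by compactness, and continuity gives both inequalities there for every
  \<open>i\<close>.\<close>

lemma poincare_miranda:
  fixes F :: "nat \<Rightarrow> (nat \<Rightarrow> real) \<Rightarrow> real" and a b :: real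
  defines "S \<equiv> {x. \<forall>i. x i \<in> {a..b}}"
  assumes "a < b" and cont: "\<And>i. i < n \<Longrightarrow> continuous_on S (F i)"
    and lo: "\<And>i x. i < n \<Longrightarrow> x \<in> S \<Longrightarrow> x i = a \<Longrightarrow> F i x \<le> 0"
    and hi: "\<And>i x. i < n \<Longrightarrow> x \<in> S \<Longrightarrow> x i = b \<Longrightarrow> F i x \<ge> 0"
  obtains x where "x \<in> S" "\<And>i. i < n \<Longrightarrow> F i x = 0"
proof -
  \<comment> \<open>Coordinates from \<open>n\<close> on are frozen at \<open>a\<close>, which keeps
    the grid points in the compact cube.\<close>
  define X where "X p q = (\<lambda>i. if i < n then a + (b - a) * (real (q i) / real p) else a)"
    for p :: nat and q :: "nat \<Rightarrow> nat"
  have X_S: "X p q \<in> S" if "p > 0" "\<forall>i<n. q i \<le> p" for p q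
  proof -
    have "0 \<le> (b - a) * (real (q i) / real p)" for i using \<open>a < b\<close> by simp
    moreover have "a + (b - a) * (real (q i) / real p) \<le> b" if "i < n" for i
    proof -
      have "(b - a) * (real (q i) / real p) \<le> (b - a) * 1"
        using \<open>a < b\<close> that \<open>\<forall>i<n. q i \<le> p\<close> \<open>p > 0\<close> by (intro mult_left_mono) auto
      then show ?thesis by simp
    qed
    ultimately show ?thesis using \<open>a < b\<close> unfolding S_def X_def by auto
  qed
  define nb where "nb q r \<longleftrightarrow> (\<forall>j<n. q j \<le> r j \<and> r j \<le> q j + 1)" for q r :: "nat \<Rightarrow> nat"
  define neg where "neg p q i r \<longleftrightarrow> nb q r \<and> X p r \<in> S \<and> F i (X p r) \<le> 0" for p q i r
  define nneg where "nneg p q i r \<longleftrightarrow> nb q r \<and> X p r \<in> S \<and> F i (X p r) \<ge> 0" for p q i r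
  have ex: "\<exists>q. (\<forall>j<n. q j < p) \<and> (\<forall>i<n. (\<exists>r. neg p q i r) \<and> (\<exists>r. nneg p q i r))" if "p > 0" for p
  proof -
    \<comment> \<open>On the faces the label is dictated by Kuhn's lemma instead of by
      \<open>F i\<close>; \<open>lo\<close> and \<open>hi\<close> ensure that label 0 still implies
      \<open>F i \<le> 0\<close> and label 1 still implies \<open>F i \<ge> 0\<close>.\<close>
    define lab where "lab x i = (if x i = p \<or> (x i \<noteq> 0 \<and> F i (X p x) > 0) then 1 else 0 :: nat)" for x i
    have lab01: "lab x i = 0 \<or> lab x i = 1" for x i by (simp add: lab_def)
    have le: "F i (X p x) \<le> 0" if "i < n" "\<forall>j<n. x j \<le> p" "lab x i = 0" for x i
      using that lo[of i "X p x"] X_S[of p x] \<open>p > 0\<close>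
      by (cases "x i = 0") (auto simp: lab_def X_def split: if_splits)
    have ge: "F i (X p x) \<ge> 0" if "i < n" "\<forall>j<n. x j \<le> p" "lab x i = 1" for x i
      using that hi[of i "X p x"] X_S[of p x] \<open>p > 0\<close>
      by (cases "x i = p") (auto simp: lab_def X_def split: if_splits)
    have "\<forall>x. (\<forall>i<n. x i \<le> p) \<longrightarrow> (\<forall>i<n. lab x i = 0 \<or> lab x i = 1)"
      "\<forall>x. (\<forall>i<n. x i \<le> p) \<longrightarrow> (\<forall>i<n. x i = 0 \<longrightarrow> lab x i = 0)"
      "\<forall>x. (\<forall>i<n. x i \<le> p) \<longrightarrow> (\<forall>i<n. x i = p \<longrightarrow> lab x i = 1)"
      using \<open>p > 0\<close> by (auto simp: lab_def)
    from kuhn_lemma[OF \<open>p > 0\<close> this] obtain q where q: "\<forall>i<n. q i < p"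
      "\<forall>i<n. \<exists>r s. nb q r \<and> nb q s \<and> lab r i \<noteq> lab s i" unfolding nb_def .
    have "(\<exists>r. neg p q i r) \<and> (\<exists>r. nneg p q i r)" if i: "i < n" for i
    proof -
      obtain r s where rs: "nb q r" "nb q s" "lab r i \<noteq> lab s i" using q(2) i by blast
      have b: "\<forall>j<n. x j \<le> p" if "nb q x" for x
      proof (intro allI impI)
        fix j assume "j < n"
        then have "x j \<le> q j + 1" "q j < p" using that q(1) by (auto simp: nb_def)
        then show "x j \<le> p" by simp
      qed
      have *: "neg p q i x" if "nb q x" "lab x i = 0" for x
        using that le[OF i b] X_S[OF \<open>p > 0\<close> b] by (simp add: neg_def)
      have **: "nneg p q i x" if "nb q x" "lab x i = 1" for x
        using that ge[OF i b] X_S[OF \<open>p > 0\<close> b] by (simp add: nneg_def)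
      show ?thesis
        using lab01[of r i] lab01[of s i]
      proof (elim disjE)
        assume "lab r i = 0" "lab s i = 1"
        then show ?thesis using * ** rs by blast
      next
        assume "lab r i = 1" "lab s i = 0"
        then show ?thesis using * ** rs by blast
      qed (use rs(3) in auto)
    qed
    then show ?thesis using q(1) by blast
  qed
  have "\<forall>k. \<exists>q. (\<forall>j<n. q j < Suc k) \<and>
      (\<forall>i<n. (\<exists>r. neg (Suc k) q i r) \<and> (\<exists>r. nneg (Suc k) q i r))"
    using ex by blast
  then obtain q where q: "\<And>k j. j < n \<Longrightarrow> q k j < Suc k"
    and "\<forall>k. \<forall>i<n. (\<exists>r. neg (Suc k) (q k) i r) \<and> (\<exists>r. nneg (Suc k) (q k) i r)" by metis
  then have "\<forall>k i. \<exists>r. i < n \<longrightarrow> neg (Suc k) (q k) i r" "\<forall>k i. \<exists>r. i < n \<longrightarrow> nneg (Suc k) (q k) i r"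
    by blast+
  then obtain R T where R: "\<And>k i. i < n \<Longrightarrow> neg (Suc k) (q k) i (R k i)"
    and T: "\<And>k i. i < n \<Longrightarrow> nneg (Suc k) (q k) i (T k i)"
    by metis
  have "X (Suc k) (q k) \<in> S" for k using X_S[of "Suc k" "q k"] q[of _ k] by (simp add: less_imp_le)
  moreover have "seq_compact S"
    using compact_cube_nat_fun[of a b] by (simp add: S_def compact_eq_seq_compact_metric)
  ultimately obtain l \<sigma> where l: "l \<in> S" "strict_mono \<sigma>"
    "((\<lambda>k. X (Suc k) (q k)) \<circ> \<sigma>) \<longlonglongrightarrow> l"
    unfolding seq_compact_def by meson
  \<comment> \<open>Whichever vertices of the cells are selected, the limit is the same, since each
    coordinate is within one mesh width of the corner \<open>q k\<close>. The selections
    \<open>R\<close> and \<open>T\<close> vary with \<open>i\<close>.\<close>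
  have lim: "(\<lambda>k. X (Suc (\<sigma> k)) (Y (\<sigma> k))) \<longlonglongrightarrow> l"
    if Y: "\<And>k. nb (q k) (Y k)" for Y
    unfolding tendsto_nat_fun
  proof
    fix j
    have 1: "(\<lambda>k. X (Suc (\<sigma> k)) (q (\<sigma> k)) j) \<longlonglongrightarrow> l j"
      using l(3) unfolding tendsto_nat_fun by simp
    have "(\<lambda>k. (b - a) / real (Suc k)) \<longlonglongrightarrow> 0"
      using tendsto_mult_right_zero[OF LIMSEQ_inverse_real_of_nat, of "b - a"]
      by (simp add: field_simps)
    from LIMSEQ_subseq_LIMSEQ[OF this l(2)]
    have 2: "(\<lambda>k. (b - a) / real (Suc (\<sigma> k))) \<longlonglongrightarrow> 0" by (simp add: o_def)
    have "\<bar>X (Suc k) (Y k) j - X (Suc k) (q k) j\<bar> \<le> (b - a) / real (Suc k)" for k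
    proof (cases "j < n")
      case True
      then have *: "\<bar>real (Y k j) - real (q k j)\<bar> \<le> 1" using Y[of k] by (auto simp: nb_def)
      have "X (Suc k) (Y k) j - X (Suc k) (q k) j
        = (b - a) / real (Suc k) * (real (Y k j) - real (q k j))"
        using True by (simp add: X_def right_diff_distrib del: of_nat_Suc)
      also have "\<bar>\<dots>\<bar> = (b - a) / real (Suc k) * \<bar>real (Y k j) - real (q k j)\<bar>"
        using \<open>a < b\<close> by (simp add: abs_mult)
      also have "\<dots> \<le> (b - a) / real (Suc k) * 1"
        using * \<open>a < b\<close> by (intro mult_left_mono) auto
      finally show ?thesis by simp
    qed (use \<open>a < b\<close> in \<open>simp add: X_def\<close>)
    then have "(\<lambda>k. X (Suc (\<sigma> k)) (Y (\<sigma> k)) j - X (Suc (\<sigma> k)) (q (\<sigma> k)) j) \<longlonglongrightarrow> 0"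
      by (intro Lim_null_comparison[OF _ 2]) auto
    from tendsto_add[OF this 1] show "(\<lambda>k. X (Suc (\<sigma> k)) (Y (\<sigma> k)) j) \<longlonglongrightarrow> l j" by simp
  qed
  have "F i l = 0" if "i < n" for i
  proof (rule antisym)
    have "(\<lambda>k. F i (X (Suc (\<sigma> k)) (R (\<sigma> k) i))) \<longlonglongrightarrow> F i l"
      by (rule continuous_on_tendsto_compose[OF cont[OF that] lim l(1)])
        (use R[OF that] in \<open>auto simp: neg_def\<close>)
    then show "F i l \<le> 0" by (rule LIMSEQ_le_const2) (use R[OF that] in \<open>auto simp: neg_def\<close>)
    have "(\<lambda>k. F i (X (Suc (\<sigma> k)) (T (\<sigma> k) i))) \<longlonglongrightarrow> F i l"
      by (rule continuous_on_tendsto_compose[OF cont[OF that] lim l(1)])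
        (use T[OF that] in \<open>auto simp: nneg_def\<close>)
    then show "F i l \<ge> 0" by (rule LIMSEQ_le_const) (use T[OF that] in \<open>auto simp: nneg_def\<close>)
  qed
  then show thesis using that l(1) by blast
qed

subsection \<open>Interpolation in Chebyshev systems\<close>

lemma one_le_zero_multiplicity:
  assumes "g x = 0"
  shows "1 \<le> zero_multiplicity g x"
proof (cases "\<forall>k. (deriv ^^ k) g x = 0")
  case False
  then have "(deriv ^^ (LEAST k. (deriv ^^ k) g x \<noteq> 0)) g x \<noteq> 0"
    using LeastI_ex[of "\<lambda>k. (deriv ^^ k) g x \<noteq> 0"] by blast
  then have "(LEAST k. (deriv ^^ k) g x \<noteq> 0) \<noteq> 0" using assms by (intro notI) simp
  then show ?thesis using False by (simp add: zero_multiplicity_def one_enat_def)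
qed (simp add: zero_multiplicity_def)

lemma two_le_zero_multiplicity:
  assumes "g x = 0" "deriv g x = 0"
  shows "2 \<le> zero_multiplicity g x"
proof (cases "\<forall>k. (deriv ^^ k) g x = 0")
  case False
  define k where "k = (LEAST k. (deriv ^^ k) g x \<noteq> 0)"
  have "(deriv ^^ k) g x \<noteq> 0"
    using False LeastI_ex[of "\<lambda>k. (deriv ^^ k) g x \<noteq> 0"] unfolding k_def by blast
  moreover from this assms have "k \<noteq> 0" by (intro notI) simp
  moreover from calculation assms have "k \<noteq> 1" by (intro notI) simp
  ultimately have "enat 2 \<le> enat k" by simp
  moreover have "enat 2 = 2" by (simp add: numeral_eq_enat)
  ultimately show ?thesis using False by (simp add: zero_multiplicity_def k_def)
qed (simp add: zero_multiplicity_def)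

lemma sum_zero_multiplicity_le:
  assumes "finite Z" "Z \<subseteq> {0..<2 * pi}"
  shows "(\<Sum>x\<in>Z. zero_multiplicity g x) \<le> zeros_with_multiplicity g"
  unfolding zeros_with_multiplicity_def using assms by (intro SUP_upper) auto

lemma card_le_sum_zero_multiplicity:
  assumes "\<And>x. x \<in> Z \<Longrightarrow> g x = 0"
  shows "enat (card Z) \<le> (\<Sum>x\<in>Z. zero_multiplicity g x)"
proof -
  have "enat (card Z) = (\<Sum>x\<in>Z. 1)" by (simp add: of_nat_eq_enat)
  also have "\<dots> \<le> (\<Sum>x\<in>Z. zero_multiplicity g x)"
    using assms by (intro sum_mono one_le_zero_multiplicity) auto
  finally show ?thesis .
qed

lemma chebyshev_system_card_zeros:
  assumes "chebyshev_system n V" "g \<in> V" "g \<noteq> 0"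
    and "finite Z" "Z \<subseteq> {0..<2 * pi}" "\<And>x. x \<in> Z \<Longrightarrow> g x = 0"
  shows "card Z < n"
proof -
  have "n > 0" using assms(1) by (auto simp: chebyshev_system_def odd_pos)
  have "enat (card Z) \<le> (\<Sum>x\<in>Z. zero_multiplicity g x)"
    using assms(6) by (rule card_le_sum_zero_multiplicity)
  also have "\<dots> \<le> zeros_with_multiplicity g" by (rule sum_zero_multiplicity_le[OF assms(4,5)])
  also have "\<dots> \<le> enat (n - 1)" using assms(1-3) by (simp add: chebyshev_system_def)
  finally show ?thesis using \<open>n > 0\<close> by simp
qed

text \<open>Distinct zeros numbering \<open>n - 1\<close> exhaust the allowed count, so a double one
  would raise it to \<open>n\<close>.\<close>

lemma chebyshev_system_simple_zeros:
  assumes "chebyshev_system n V" "g \<in> V" "g \<noteq> 0"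
    and "finite Z" "Z \<subseteq> {0..<2 * pi}" "\<And>x. x \<in> Z \<Longrightarrow> g x = 0" and card: "Suc (card Z) = n"
    and "x \<in> Z"
  shows "deriv g x \<noteq> 0"
proof
  assume "deriv g x = 0"
  have "card Z = Suc (card (Z - {x}))" using card_Suc_Diff1[OF assms(4,8)] by simp
  then have "n = card (Z - {x}) + 2" using card by simp
  then have "enat n = enat (card (Z - {x})) + 2" by (simp add: numeral_eq_enat)
  also have "\<dots> \<le> (\<Sum>y\<in>Z - {x}. zero_multiplicity g y) + zero_multiplicity g x"
    using assms \<open>deriv g x = 0\<close>
    by (intro add_mono card_le_sum_zero_multiplicity two_le_zero_multiplicity) auto
  also have "\<dots> = (\<Sum>y\<in>Z. zero_multiplicity g y)"
    using assms(4,8) by (simp add: sum.remove[of Z x] add.commute)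
  also have "\<dots> \<le> zeros_with_multiplicity g" by (rule sum_zero_multiplicity_le[OF assms(4,5)])
  also have "\<dots> \<le> enat (n - 1)" using assms(1-3) by (simp add: chebyshev_system_def)
  finally show False using card by simp
qed

lemma chebyshev_system_continuous:
  assumes "chebyshev_system n V" "g \<in> V"
  shows "continuous_on UNIV g"
  using assms C_k_imp_continuous by (auto simp: chebyshev_system_def)

text \<open>Evaluation at \<open>n\<close> nodes is injective on \<open>V\<close>, as no non-zero
  member has \<open>n\<close> zeros; since \<open>dim V = n\<close> it is onto, and
  \<open>L j\<close> is the preimage of the \<open>j\<close>-th unit vector. Injectivity also shows
  that \<open>g\<close> equals its interpolant.\<close>

lemma chebyshev_system_interpolation:
  assumes cheb: "chebyshev_system n V"
    and x: "inj_on x {..<n}" "x ` {..<n} \<subseteq> {0..<2 * pi}"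
  obtains L :: "nat \<Rightarrow> real \<Rightarrow> real" where "\<forall>j<n. L j \<in> V"
    "\<forall>i<n. \<forall>j<n. L j (x i) = (if i = j then 1 else 0)"
    "\<forall>g\<in>V. \<forall>y. g y = (\<Sum>j<n. g (x j) * L j y)"
proof -
  have V: "subspace V" "dim V = n" "n > 0"
    using cheb by (auto simp: chebyshev_system_def odd_pos)
  have zero: "g = 0" if "g \<in> V" "\<And>i. i < n \<Longrightarrow> g (x i) = 0" for g
  proof (rule ccontr)
    assume "g \<noteq> 0"
    then have "card (x ` {..<n}) < n"
      using x that by (intro chebyshev_system_card_zeros[OF cheb \<open>g \<in> V\<close> \<open>g \<noteq> 0\<close>]) auto
    then show False using x by (simp add: card_image)
  qed
  \<comment> \<open>Values from \<open>n\<close> on are padded with 0, so the image lies in the span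
    of the first \<open>n\<close> unit vectors. The target type has infinite dimension, so
    surjectivity onto that span is a count: a missing unit vector would yield \<open>n + 1\<close>
    independent vectors in a span of \<open>n\<close>.\<close>
  define E :: "(real \<Rightarrow> real) \<Rightarrow> nat \<Rightarrow> real" where "E g = (\<lambda>i. if i < n then g (x i) else 0)" for g
  define e :: "nat \<Rightarrow> nat \<Rightarrow> real" where "e j = (\<lambda>i. if i = j then 1 else 0)" for j
  have lin: "linear E"
    by (rule linearI) (auto simp: E_def scaleR_fun_def fun_eq_iff)
  obtain B where B: "B \<subseteq> V" "independent B" "V \<subseteq> span B" "card B = n"
    using basis_exists[of V] V(2) by blast
  have spanB: "span B = V" using B V(1) by (simp add: span_minimal subset_antisym)
  have "finite B" using B(4) \<open>n > 0\<close> by (simp add: card_ge_0_finite)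
  have inj: "inj_on E V"
  proof (rule inj_onI)
    fix g h assume gh: "g \<in> V" "h \<in> V" "E g = E h"
    have "g - h = 0"
    proof (rule zero)
      show "g - h \<in> V" using gh V(1) by (simp add: subspace_diff)
      show "(g - h) (x i) = 0" if "i < n" for i
        using fun_cong[OF gh(3), of i] that by (simp add: E_def)
    qed
    then show "g = h" by simp
  qed
  have indep: "independent (E ` B)"
    using lin B(2) inj spanB by (intro linear_independent_injective_image) auto
  have cardEB: "card (E ` B) = n"
    using B inj inj_on_subset by (metis card_image)
  have sum_e: "v = (\<Sum>j<n. v j *\<^sub>R e j)" if "\<And>i. i \<ge> n \<Longrightarrow> v i = 0" for v :: "nat \<Rightarrow> real"
  proof
    fix i
    have "(\<Sum>j<n. v j *\<^sub>R e j) i = (\<Sum>j<n. v j * e j i)"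
      by (induction n) (auto simp: scaleR_fun_def)
    also have "\<dots> = v i"
      using that[of i] by (cases "i < n") (auto simp: e_def if_distrib cong: if_cong)
    finally show "v i = (\<Sum>j<n. v j *\<^sub>R e j) i" by simp
  qed
  have sub: "v \<in> span (e ` {..<n})" if "\<And>i. i \<ge> n \<Longrightarrow> v i = 0" for v
  proof -
    have "(\<Sum>j<n. v j *\<^sub>R e j) \<in> span (e ` {..<n})"
      by (intro span_sum span_scale span_base) auto
    then show ?thesis using sum_e[OF that] by simp
  qed
  have "e j \<in> E ` V" if "j < n" for j
  proof (rule ccontr)
    assume "e j \<notin> E ` V"
    then have ni: "e j \<notin> span (E ` B)" using lin spanB by (simp add: linear_span_image)
    then have "independent (insert (e j) (E ` B))" using indep by (simp add: independent_insert)
    moreover have "insert (e j) (E ` B) \<subseteq> span (e ` {..<n})"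
      using that sub[of "E b" for b] span_base[of "e j" "e ` {..<n}"] by (auto simp: E_def)
    ultimately have "card (insert (e j) (E ` B)) \<le> card (e ` {..<n})"
      using independent_span_bound[of "e ` {..<n}"] by blast
    also have "\<dots> \<le> n" using card_image_le[of "{..<n}" e] by simp
    finally have "card (insert (e j) (E ` B)) \<le> n" .
    moreover have "e j \<notin> E ` B" using ni span_superset[of "E ` B"] by (rule contra_subsetD[rotated])
    ultimately show False using \<open>finite B\<close> cardEB by simp
  qed
  then have "\<forall>j. \<exists>g. j < n \<longrightarrow> g \<in> V \<and> E g = e j" by (metis imageE)
  then obtain L where L: "\<And>j. j < n \<Longrightarrow> L j \<in> V" "\<And>j. j < n \<Longrightarrow> E (L j) = e j" by metis
  have Lx: "L j (x i) = (if i = j then 1 else 0)" if "i < n" "j < n" for i j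
    using fun_cong[OF L(2)[OF that(2)], of i] that by (simp add: E_def e_def)
  have "g y = (\<Sum>j<n. g (x j) * L j y)" if "g \<in> V" for g y
  proof -
    have app: "(\<Sum>j\<in>J. c j *\<^sub>R L j) y = (\<Sum>j\<in>J. c j * L j y)" for c y and J :: "nat set"
      by (induction J rule: infinite_finite_induct) (auto simp: scaleR_fun_def)
    have "g - (\<Sum>j<n. g (x j) *\<^sub>R L j) = 0"
    proof (rule zero)
      show "g - (\<Sum>j<n. g (x j) *\<^sub>R L j) \<in> V"
        using V(1) that L(1) by (intro subspace_diff subspace_sum subspace_scale) auto
      show "(g - (\<Sum>j<n. g (x j) *\<^sub>R L j)) (x i) = 0" if "i < n" for i
        using that by (simp add: app Lx if_distrib cong: if_cong)
    qed
    then have "g = (\<Sum>j<n. g (x j) *\<^sub>R L j)" by simp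
    from fun_cong[OF this, of y] show ?thesis by (simp only: app)
  qed
  then show thesis using that L(1) Lx by blast
qed

section \<open>Signs of the interpolating functions at the last node\<close>

lemma same_sign_if_no_zero:
  fixes h :: "real \<Rightarrow> real"
  assumes "a \<le> c" "continuous_on {a..c} h" "\<And>y. y \<in> {a..c} \<Longrightarrow> h y \<noteq> 0"
  shows "h a * h c > 0"
proof (rule ccontr)
  assume "\<not> h a * h c > 0"
  then have "h a \<le> 0 \<and> 0 \<le> h c \<or> h c \<le> 0 \<and> 0 \<le> h a" by (auto simp: not_less mult_le_0_iff)
  then have "\<exists>y. a \<le> y \<and> y \<le> c \<and> h y = 0"
    using IVT'[of h a 0 c] IVT2'[of h c 0 a] assms by blast
  then show False using assms(3) by auto
qed

text \<open>The nonzero derivative gives opposite signs just left and right of \<open>b\<close>;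
  with no other zero in the interval, each sign persists to the end of its side.\<close>

lemma sign_change_at_simple_zero:
  fixes h :: "real \<Rightarrow> real"
  assumes "a < b" "b < c" "continuous_on {a..c} h" "(h has_real_derivative d) (at b)" "d \<noteq> 0"
    and "h b = 0" and nz: "\<And>y. y \<in> {a..c} \<Longrightarrow> y \<noteq> b \<Longrightarrow> h y \<noteq> 0"
  shows "h a * h c < 0"
proof -
  have "\<exists>p q. a < p \<and> p < b \<and> b < q \<and> q < c \<and> h p * h q < 0"
  proof -
    \<comment> \<open>Multiplication by \<open>d\<close> merges the two cases: \<open>d * h\<close>
      increases through \<open>b\<close> whatever the sign of \<open>d\<close>.\<close>
    obtain r s where "r > 0" "s > 0"
      and rs: "\<And>k. k > 0 \<Longrightarrow> k < r \<Longrightarrow> d * h (b + k) > 0" "\<And>k. k > 0 \<Longrightarrow> k < s \<Longrightarrow> d * h (b - k) < 0"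
    proof (cases "d > 0")
      case True
      obtain r s where "r > 0" "s > 0" "\<And>k. k > 0 \<Longrightarrow> k < r \<Longrightarrow> h b < h (b + k)"
        "\<And>k. k > 0 \<Longrightarrow> k < s \<Longrightarrow> h (b - k) < h b"
        using DERIV_pos_inc_right[OF assms(4) True] DERIV_pos_inc_left[OF assms(4) True] by metis
      then show thesis using that[of r s] assms(6) True by (simp add: mult_pos_neg)
    next
      case False
      then have d: "d < 0" using assms(5) by simp
      obtain r s where "r > 0" "s > 0" "\<And>k. k > 0 \<Longrightarrow> k < r \<Longrightarrow> h b > h (b + k)"
        "\<And>k. k > 0 \<Longrightarrow> k < s \<Longrightarrow> h (b - k) > h b"
        using DERIV_neg_dec_right[OF assms(4) d] DERIV_neg_dec_left[OF assms(4) d] by metis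
      then show thesis using that[of r s] assms(6) d by (simp add: mult_neg_neg mult_neg_pos)
    qed
    define k where "k = min (min r s) (min (b - a) (c - b)) / 2"
    have k: "k > 0" "k < r" "k < s" "k < b - a" "k < c - b"
      using \<open>r > 0\<close> \<open>s > 0\<close> assms(1,2) by (auto simp: k_def min_def)
    have "(d * h (b - k)) * (d * h (b + k)) < 0" using rs k by (simp add: mult_neg_pos)
    then have "d\<^sup>2 * (h (b - k) * h (b + k)) < 0" by (simp add: power2_eq_square mult_ac)
    then have "h (b - k) * h (b + k) < 0" using assms(5) by (simp add: mult_less_0_iff)
    then show ?thesis using k by (intro exI[of _ "b - k"] exI[of _ "b + k"]) auto
  qed
  then obtain p q where pq: "a < p" "p < b" "b < q" "q < c" "h p * h q < 0" by blast
  have "continuous_on {a..p} h" "continuous_on {q..c} h"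
    using pq assms(3) by (auto elim: continuous_on_subset)
  then have "h a * h p > 0" "h q * h c > 0"
    using pq nz same_sign_if_no_zero[of a p h] same_sign_if_no_zero[of q c h] by auto
  then show ?thesis using pq(5) by (auto simp: zero_less_mult_iff mult_less_0_iff)
qed

text \<open>The nodes other than \<open>x j\<close> and \<open>x n\<close> are \<open>n - 1\<close>
  zeros of \<open>g\<close>, so there are no further ones in the period and all are simple. From
  \<open>x j\<close>, where \<open>g\<close> is 1, to \<open>x n\<close> exactly
  \<open>n - 1 - j\<close> of them are crossed, and each crossing flips the sign.\<close>

lemma chebyshev_system_interpolation_sign:
  assumes cheb: "chebyshev_system n V"
    and mono: "strict_mono_on {..n} x" and ran: "x ` {..n} \<subseteq> {0..<2 * pi}"
    and g: "g \<in> V" "j < n" "\<And>i. i < n \<Longrightarrow> g (x i) = (if i = j then 1 else 0)"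
  shows "(- 1) ^ (n - 1 - j) * g (x n) > 0"
proof -
  have less: "x i < x k" if "i < k" "k \<le> n" for i k
    using mono that by (auto simp: strict_mono_on_def)
  have x_eq: "x i = x k \<longleftrightarrow> i = k" if "i \<le> n" "k \<le> n" for i k
    using less[of i k] less[of k i] that by (metis less_irrefl linorder_neqE_nat)
  have "g \<noteq> 0" using g by (auto simp: fun_eq_iff intro!: exI[of _ "x j"])
  have cont: "continuous_on S g" for S
    using chebyshev_system_continuous[OF cheb g(1)] continuous_on_subset by blast
  define Z where "Z = x ` ({..<n} - {j})"
  have Z: "finite Z" "\<And>y. y \<in> Z \<Longrightarrow> g y = 0" using g(3) by (auto simp: Z_def split: if_splits)
  have Z_sub: "Z \<subseteq> {0..<2 * pi}" 
  proof -
    have "Z \<subseteq> x ` {..n}" unfolding Z_def by (intro image_mono) auto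
    then show ?thesis using ran by simp
  qed
  have cardZ: "Suc (card Z) = n"
  proof -
    have "inj_on x ({..<n} - {j})" by (rule inj_onI) (use x_eq in auto)
    then show ?thesis using g(2) by (simp add: Z_def card_image)
  qed
  have other: "y \<in> Z" if "g y = 0" "y \<in> {0..<2 * pi}" for y
  proof (rule ccontr)
    assume "y \<notin> Z"
    then have "card (insert y Z) = n" using Z(1) cardZ by simp
    moreover have "card (insert y Z) < n"
      using Z Z_sub that by (intro chebyshev_system_card_zeros[OF cheb g(1) \<open>g \<noteq> 0\<close>]) auto
    ultimately show False by simp
  qed
  have range: "y \<in> {0..<2 * pi}" if "x i \<le> y" "y \<le> x k" "i \<le> n" "k \<le> n" for y i k
  proof -
    have "x i \<in> {0..<2 * pi}" "x k \<in> {0..<2 * pi}" using that ran by blast+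
    then show ?thesis using that by auto
  qed
  have gap: "g y \<noteq> 0" if "k < n" "x k < y" "y < x (Suc k)" for y k
  proof
    assume "g y = 0"
    then have "y \<in> Z" using other range[of k y "Suc k"] that by simp
    then obtain i where i: "i < n" "y = x i" by (auto simp: Z_def)
    show False
    proof (cases "i \<le> k")
      case True
      then have "x i \<le> x k" using less[of i k] that by (cases "i = k") auto
      then show False using i that by simp
    next
      case False
      then have "x (Suc k) \<le> x i" using less[of "Suc k" i] i by (cases "i = Suc k") auto
      then show False using i that by simp
    qed
  qed
  \<comment> \<open>Midpoints between consecutive nodes: sample points at which \<open>g\<close>
    cannot vanish, so that its sign can be tracked.\<close>
  define m where "m k = (x k + x (Suc k)) / 2" for k
  have m: "x k < m k" "m k < x (Suc k)" if "k < n" for k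
    using less[of k "Suc k"] that by (auto simp: m_def)
  have "j + d < n \<Longrightarrow> (- 1) ^ d * g (m (j + d)) > 0" for d
  proof (induction d)
    case 0
    have "g (x j) * g (m j) > 0"
    proof (rule same_sign_if_no_zero[OF _ cont])
      show "x j \<le> m j" using m[of j] g(2) by simp
      show "g y \<noteq> 0" if "y \<in> {x j..m j}" for y
        using gap[of j y] m[of j] g that by (cases "y = x j") auto
    qed
    then show ?case using g by simp
  next
    case (Suc d)
    define k where "k = j + d"
    have k: "Suc k < n" "k < n" using Suc by (auto simp: k_def)
    have Sk: "x (Suc k) \<in> Z" using k by (auto simp: Z_def k_def)
    \<comment> \<open>This step is reached only if \<open>Suc k < n\<close>, hence
      \<open>n \<ge> 2\<close>, so regularity \<open>n - 1\<close> includes a derivative. For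
      \<open>n = 1\<close> members of \<open>V\<close> are only known to be continuous, but no zero
      has to be crossed.\<close>
    have "C_k (n - 1) g" using cheb g(1) by (simp add: chebyshev_system_def)
    moreover have "n - 1 = Suc (n - 2)" using k by simp
    ultimately have "C_k (Suc (n - 2)) g" by simp
    then have D: "(g has_real_derivative deriv g y) (at y)" for y
      by (metis C_k_Suc DERIV_deriv_iff_real_differentiable)
    have "g (m k) * g (m (Suc k)) < 0"
    proof (rule sign_change_at_simple_zero[OF _ _ cont D])
      show "m k < x (Suc k)" "x (Suc k) < m (Suc k)" using m k by auto
      show "deriv g (x (Suc k)) \<noteq> 0"
        by (rule chebyshev_system_simple_zeros[OF cheb g(1) \<open>g \<noteq> 0\<close> Z(1) Z_sub Z(2) cardZ Sk])
      show "g (x (Suc k)) = 0" using Z Sk by blast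
      show "g y \<noteq> 0" if "y \<in> {m k..m (Suc k)}" "y \<noteq> x (Suc k)" for y
        using gap[of k y] gap[of "Suc k" y] m[of k] m[of "Suc k"] k that by force
    qed
    moreover have "(- 1) ^ d * g (m k) > 0" using Suc by (simp add: k_def)
    moreover have "j + Suc d = Suc k" by (simp add: k_def)
    ultimately show ?case by (auto simp: zero_less_mult_iff mult_less_0_iff)
  qed
  from this[of "n - 1 - j"] have "(- 1) ^ (n - 1 - j) * g (m (n - 1)) > 0" using g(2) by simp
  moreover have "g (m (n - 1)) * g (x n) > 0"
  proof (rule same_sign_if_no_zero[OF _ cont])
    show "m (n - 1) \<le> x n" using m[of "n - 1"] g(2) by simp
    show "g y \<noteq> 0" if "y \<in> {m (n - 1)..x n}" for y
    proof (cases "y = x n")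
      case True
      have "x n \<notin> Z" using x_eq by (auto simp: Z_def)
      then show ?thesis using True other ran by auto
    next
      case False
      then show ?thesis using gap[of "n - 1" y] m[of "n - 1"] g(2) that by auto
    qed
  qed
  ultimately show ?thesis by (auto simp: zero_less_mult_iff mult_less_0_iff)
qed

subsection \<open>Solving the orthogonality equations\<close>

text \<open>By the mean value theorem each increment of \<open>G j\<close> is
  \<open>w i * L j (x i)\<close> up to \<open>w i * \<eta>\<close>. For
  \<open>w i = h * \<mu> i\<close> the linear parts cancel by \<open>rel\<close>. A relative change
  \<open>a i\<close> contributes a multiple of \<open>L j (x i)\<close>, which for
  \<open>i < n\<close> vanishes unless \<open>i = j\<close>, and the last length is not varied. So
  the linear part is diagonal in \<open>a\<close>, with an error that is a prescribed fraction of
  \<open>h\<close>.\<close>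

lemma small_masses_linearization:
  fixes p \<mu> x :: "nat \<Rightarrow> real" and L G :: "nat \<Rightarrow> real \<Rightarrow> real"
  assumes L: "\<And>j. j < n \<Longrightarrow> continuous_on UNIV (L j)"
    and DG: "\<And>j y. j < n \<Longrightarrow> (G j has_real_derivative L j y) (at y)"
    and Lx: "\<And>i j. i < n \<Longrightarrow> j < n \<Longrightarrow> L j (x i) = (if i = j then 1 else 0)"
    and \<mu>: "\<And>i. i \<le> n \<Longrightarrow> \<mu> i > 0"
    and rel: "\<And>j. j < n \<Longrightarrow> (\<Sum>i\<le>n. p i * \<mu> i * L j (x i)) = 0"
    and "e > 0" "\<Delta> > 0"
  obtains h where "h > 0" "\<And>i. i \<le> n \<Longrightarrow> h * \<mu> i * (3 / 2) < \<Delta>"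
    "\<And>j a w. \<lbrakk>j < n; \<And>i. i < n \<Longrightarrow> \<bar>a i\<bar> \<le> 1 / 2;
        \<And>i. i < n \<Longrightarrow> w i = h * \<mu> i * (1 + a i); w n = h * \<mu> n\<rbrakk> \<Longrightarrow>
      \<bar>(\<Sum>i\<le>n. p i * (G j (x i + w i) - G j (x i))) - h * (p j * \<mu> j * a j)\<bar> \<le> h * e"
proof -
  define \<Lambda> where "\<Lambda> = (\<Sum>i\<le>n. \<bar>p i\<bar> * \<mu> i)"
  have "\<Lambda> \<ge> 0" unfolding \<Lambda>_def using \<mu> by (intro sum_nonneg mult_nonneg_nonneg) (auto simp: less_imp_le)
  \<comment> \<open>Lengths are at most 3/2 times \<open>h * \<mu> i\<close>, so the total error is
    at most h (3/2) \<Lambda> \<eta>. The summand 1 keeps the denominator positive when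
    \<open>\<Lambda>\<close> is 0.\<close>
  define \<eta> where "\<eta> = e / (3 / 2 * \<Lambda> + 1)"
  have "\<eta> > 0" unfolding \<eta>_def using \<open>e > 0\<close> \<open>\<Lambda> \<ge> 0\<close> by (intro divide_pos_pos) auto
  have \<eta>: "3 / 2 * \<Lambda> * \<eta> \<le> e"
  proof -
    have "3 / 2 * \<Lambda> * \<eta> \<le> (3 / 2 * \<Lambda> + 1) * \<eta>" using \<open>\<eta> > 0\<close> by (intro mult_right_mono) auto
    also have "\<dots> = e" unfolding \<eta>_def using \<open>\<Lambda> \<ge> 0\<close> by simp
    finally show ?thesis .
  qed
  \<comment> \<open>Finitely many smallness conditions on \<open>h\<close>, met together by letting
    \<open>h\<close> tend to 0 from the right.\<close>
  have "\<forall>\<^sub>F h in at_right 0. h * \<mu> i * (3 / 2) < \<Delta> \<and>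
      (\<forall>j<n. \<forall>y. \<bar>y - x i\<bar> \<le> h * \<mu> i * (3 / 2) \<longrightarrow> \<bar>L j y - L j (x i)\<bar> \<le> \<eta>)" if i: "i \<le> n" for i
  proof -
    have lim: "((\<lambda>h. h * \<mu> i * (3 / 2)) \<longlongrightarrow> 0) (at_right 0)"
      by (auto intro!: tendsto_eq_intros)
    have "\<forall>\<^sub>F h in at_right 0. \<forall>y. \<bar>y - x i\<bar> \<le> h * \<mu> i * (3 / 2) \<longrightarrow> \<bar>L j y - L j (x i)\<bar> \<le> \<eta>"
      if j: "j < n" for j
    proof -
      have "isCont (L j) (x i)" using L[OF j] by (simp add: continuous_on_eq_continuous_at)
      then obtain s where s: "s > 0" "\<And>y. \<bar>y - x i\<bar> < s \<Longrightarrow> \<bar>L j y - L j (x i)\<bar> < \<eta>"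
        using \<open>\<eta> > 0\<close> unfolding continuous_at_eps_delta dist_real_def by blast
      show ?thesis
        using order_tendstoD(2)[OF lim s(1)]
        by eventually_elim (use s(2) in \<open>meson le_less_trans less_imp_le\<close>)
    qed
    then have "\<forall>\<^sub>F h in at_right 0. \<forall>j\<in>{..<n}. \<forall>y. \<bar>y - x i\<bar> \<le> h * \<mu> i * (3 / 2) \<longrightarrow>
        \<bar>L j y - L j (x i)\<bar> \<le> \<eta>"
      by (intro eventually_ball_finite) auto
    with order_tendstoD(2)[OF lim \<open>\<Delta> > 0\<close>] show ?thesis by eventually_elim auto
  qed
  then have "\<forall>\<^sub>F h in at_right 0. \<forall>i\<in>{..n}. h * \<mu> i * (3 / 2) < \<Delta> \<and>
      (\<forall>j<n. \<forall>y. \<bar>y - x i\<bar> \<le> h * \<mu> i * (3 / 2) \<longrightarrow> \<bar>L j y - L j (x i)\<bar> \<le> \<eta>)"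
    by (intro eventually_ball_finite) auto
  moreover have "\<forall>\<^sub>F h in at_right (0 :: real). h > 0" by (simp add: eventually_at_right_less)
  ultimately have "\<forall>\<^sub>F h in at_right 0. h > 0 \<and> (\<forall>i\<in>{..n}. h * \<mu> i * (3 / 2) < \<Delta> \<and>
      (\<forall>j<n. \<forall>y. \<bar>y - x i\<bar> \<le> h * \<mu> i * (3 / 2) \<longrightarrow> \<bar>L j y - L j (x i)\<bar> \<le> \<eta>))"
    by eventually_elim blast
  then obtain h where h: "h > 0" "\<And>i. i \<le> n \<Longrightarrow> h * \<mu> i * (3 / 2) < \<Delta>"
    "\<And>i j y. i \<le> n \<Longrightarrow> j < n \<Longrightarrow> \<bar>y - x i\<bar> \<le> h * \<mu> i * (3 / 2) \<Longrightarrow> \<bar>L j y - L j (x i)\<bar> \<le> \<eta>"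
    using eventually_happens'[of "at_right (0 :: real)"] by (force simp: trivial_limit_at_right_real)
  have "\<bar>(\<Sum>i\<le>n. p i * (G j (x i + w i) - G j (x i))) - h * (p j * \<mu> j * a j)\<bar> \<le> h * e"
    if j: "j < n" and a: "\<And>i. i < n \<Longrightarrow> \<bar>a i\<bar> \<le> 1 / 2"
      and w: "\<And>i. i < n \<Longrightarrow> w i = h * \<mu> i * (1 + a i)" "w n = h * \<mu> n" for j a w
  proof -
    have w_bounds: "0 < w i" "w i \<le> h * \<mu> i * (3 / 2)" if i: "i \<le> n" for i
    proof -
      define b where "b = 1 + (if i < n then a i else 0)"
      have "1 / 2 \<le> b" "b \<le> 3 / 2" using a[of i] by (auto simp: b_def abs_le_iff)
      moreover have "w i = h * \<mu> i * b" using w i by (cases "i = n") (auto simp: b_def)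
      ultimately show "0 < w i" "w i \<le> h * \<mu> i * (3 / 2)"
        using h(1) \<mu>[OF i] by (auto intro!: mult_left_mono)
    qed
    have step: "\<bar>G j (x i + w i) - G j (x i) - w i * L j (x i)\<bar> \<le> w i * \<eta>" if i: "i \<le> n" for i
    proof -
      obtain z where z: "x i < z" "z < x i + w i" "G j (x i + w i) - G j (x i) = (x i + w i - x i) * L j z"
        using MVT2[of "x i" "x i + w i" "G j" "L j"] w_bounds[OF i] DG[OF j] by auto
      have "\<bar>L j z - L j (x i)\<bar> \<le> \<eta>" using z w_bounds[OF i] by (intro h(3) i j) auto
      then have "w i * \<bar>L j z - L j (x i)\<bar> \<le> w i * \<eta>" using w_bounds[OF i] by (intro mult_left_mono) auto
      moreover have "w i * \<bar>L j z - L j (x i)\<bar> = \<bar>w i * L j z - w i * L j (x i)\<bar>"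
        using w_bounds[OF i] by (simp add: abs_mult right_diff_distrib[symmetric])
      ultimately show ?thesis using z(3) by simp
    qed
    have lin: "(\<Sum>i\<le>n. p i * (w i * L j (x i))) = h * (p j * \<mu> j * a j)"
    proof -
      have "(\<Sum>i\<le>n. p i * (w i * L j (x i))) - h * (\<Sum>i\<le>n. p i * \<mu> i * L j (x i))
        = (\<Sum>i\<le>n. p i * (w i - h * \<mu> i) * L j (x i))"
        by (simp add: sum_distrib_left sum_subtractf[symmetric] algebra_simps)
      also have "\<dots> = (\<Sum>i<n. p i * (w i - h * \<mu> i) * L j (x i))"
        using w(2) by (simp add: lessThan_Suc_atMost[symmetric])
      also have "\<dots> = (\<Sum>i<n. if i = j then p j * (w j - h * \<mu> j) else 0)"
        using Lx j by (intro sum.cong) auto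
      also have "\<dots> = h * (p j * \<mu> j * a j)" using j w(1)[OF j] by (simp add: algebra_simps)
      finally show ?thesis using rel[OF j] by simp
    qed
    have "\<bar>(\<Sum>i\<le>n. p i * (G j (x i + w i) - G j (x i))) - h * (p j * \<mu> j * a j)\<bar>
      = \<bar>\<Sum>i\<le>n. p i * (G j (x i + w i) - G j (x i) - w i * L j (x i))\<bar>"
      unfolding lin[symmetric] by (simp add: sum_subtractf[symmetric] right_diff_distrib)
    also have "\<dots> \<le> (\<Sum>i\<le>n. h * (3 / 2) * \<eta> * (\<bar>p i\<bar> * \<mu> i))"
    proof (rule order_trans[OF sum_abs], rule sum_mono)
      fix i assume "i \<in> {..n}"
      then have i: "i \<le> n" by simp
      have "\<bar>p i\<bar> * \<bar>G j (x i + w i) - G j (x i) - w i * L j (x i)\<bar> \<le> \<bar>p i\<bar> * (h * \<mu> i * (3 / 2) * \<eta>)"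
        using order_trans[OF step[OF i] mult_right_mono[OF w_bounds(2)[OF i], of \<eta>]] \<open>\<eta> > 0\<close>
        by (intro mult_left_mono) auto
      then show "\<bar>p i * (G j (x i + w i) - G j (x i) - w i * L j (x i))\<bar> \<le> h * (3 / 2) * \<eta> * (\<bar>p i\<bar> * \<mu> i)"
        by (simp add: abs_mult mult_ac)
    qed
    also have "\<dots> = h * (3 / 2) * \<eta> * \<Lambda>" unfolding \<Lambda>_def by (rule sum_distrib_left[symmetric])
    also have "\<dots> = h * (3 / 2 * \<Lambda> * \<eta>)" by simp
    also have "\<dots> \<le> h * e" using \<eta> h(1) by (intro mult_left_mono) auto
    finally show ?thesis .
  qed
  then show thesis using that h(1,2) by blast
qed

lemma sum_lessThan_double: "(\<Sum>k<2 * r. u k) = (\<Sum>i<r. u (2 * i) + u (Suc (2 * i)))"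
  for u :: "nat \<Rightarrow> real"
  by (induction r) (auto simp: algebra_simps)

text \<open>The error budget: linearization and smoothing may each cost a quarter of
  \<open>h * \<kappa>\<close>. On the faces \<open>a j = - 1 / 2\<close> and
  \<open>a j = 1 / 2\<close> the diagonal term has size at least \<open>h * \<kappa> / 2\<close>,
  exactly what the two errors can consume, so it decides the sign.\<close>

lemma exists_orthogonal_masses:
  fixes f :: "real \<Rightarrow> real" and c d x \<mu> :: "nat \<Rightarrow> real" and L :: "nat \<Rightarrow> real \<Rightarrow> real"
  assumes f: "continuous_on UNIV f"
    and cd: "\<And>k. k < 2 * Suc n \<Longrightarrow> d k < c k \<and> c k < d (Suc k)" "d (2 * Suc n) = d 0 + 2 * pi"
    and zero: "\<And>i. i \<le> n \<Longrightarrow> f (c (Suc (2 * i))) = 0"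
    and nz: "\<And>i. i < n \<Longrightarrow> f (c (2 * i)) \<noteq> 0"
    and x: "\<And>i. x i = 2 * pi / Suc n * i"
    and L: "\<And>j. j < n \<Longrightarrow> continuous_on UNIV (L j)" and LB: "\<And>j y. j < n \<Longrightarrow> \<bar>L j y\<bar> \<le> B"
    and Lx: "\<And>i j. i < n \<Longrightarrow> j < n \<Longrightarrow> L j (x i) = (if i = j then 1 else 0)"
    and \<mu>: "\<And>i. i \<le> n \<Longrightarrow> \<mu> i > 0"
    and rel: "\<And>j. j < n \<Longrightarrow> (\<Sum>i\<le>n. f (c (2 * i)) * \<mu> i * L j (x i)) = 0"
    and "B \<ge> 0" "n > 0"
  obtains \<psi> where "smooth \<psi>" "\<forall>y. deriv \<psi> y > 0" "\<psi> (d 0) = 0" "\<forall>y. \<psi> (y + 2 * pi) = \<psi> y + 2 * pi"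
    "\<forall>j<n. integral {d 0..d 0 + 2 * pi} (\<lambda>y. f y * (L j (\<psi> y) * deriv \<psi> y)) = 0"
proof -
  define \<Delta> where "\<Delta> = 2 * pi / Suc n"
  have "\<Delta> > 0" by (simp add: \<Delta>_def)
  define p where "p i = f (c (2 * i))" for i
  have "\<exists>G. \<forall>y. (G has_real_derivative L j y) (at y)" if "j < n" for j
    using continuous_antiderivative[OF L[OF that]] by metis
  then obtain G where DG: "\<And>j y. j < n \<Longrightarrow> (G j has_real_derivative L j y) (at y)" by metis
  define \<kappa> where "\<kappa> = Min ((\<lambda>j. \<bar>p j\<bar> * \<mu> j) ` {..<n})"
  have "\<kappa> > 0" unfolding \<kappa>_def using \<open>n > 0\<close> nz \<mu>
    by (subst Min_gr_iff) (auto simp: p_def lessThan_empty_iff less_imp_le)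
  have \<kappa>: "\<kappa> \<le> \<bar>p j\<bar> * \<mu> j" if "j < n" for j using that by (simp add: \<kappa>_def)
  have "\<kappa> / 4 > 0" using \<open>\<kappa> > 0\<close> by simp
  obtain h where h: "h > 0" "\<And>i. i \<le> n \<Longrightarrow> h * \<mu> i * (3 / 2) < \<Delta>"
    "\<And>j a w. \<lbrakk>j < n; \<And>i. i < n \<Longrightarrow> \<bar>a i\<bar> \<le> 1 / 2;
        \<And>i. i < n \<Longrightarrow> w i = h * \<mu> i * (1 + a i); w n = h * \<mu> n\<rbrakk> \<Longrightarrow>
      \<bar>(\<Sum>i\<le>n. p i * (G j (x i + w i) - G j (x i))) - h * (p j * \<mu> j * a j)\<bar> \<le> h * (\<kappa> / 4)"
    using small_masses_linearization[OF L DG Lx \<mu> rel[folded p_def] \<open>\<kappa> / 4 > 0\<close> \<open>\<Delta> > 0\<close>] by blast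
  have "h * (\<kappa> / 4) > 0" using h(1) \<open>\<kappa> > 0\<close> by simp
  have "0 < 2 * Suc n" by simp
  then obtain H :: "nat \<Rightarrow> real \<Rightarrow> real" where
    smH: "\<And>k. smooth (H k)" and dH: "\<And>k y. deriv (H k) y > 0" and H0: "\<And>k. H k (d 0) = 0"
    and Hper: "\<And>k y. H k (y + 2 * pi) = H k y + 1"
    and approx: "approximates_jumps f c (d 0) (2 * Suc n) B (h * (\<kappa> / 4)) H"
    using smoothed_jumps[OF f cd _ \<open>h * (\<kappa> / 4) > 0\<close> \<open>B \<ge> 0\<close>] by blast
  define w where "w a i = h * \<mu> i * (1 + (if i < n then a i else 0))" for a :: "nat \<Rightarrow> real" and i
  \<comment> \<open>Each even index and its odd successor share the mass \<open>\<Delta>\<close>, so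
    partial sums over whole pairs do not depend on \<open>a\<close>.\<close>
  define m where "m a k = (if even k then w a (k div 2) else \<Delta> - w a (k div 2))" for a k
  \<comment> \<open>Relative changes of at most 1/2 keep every \<open>w a i\<close> positive and, by
    the choice of \<open>h\<close>, below \<open>\<Delta>\<close>, so all masses are
    positive.\<close>
  define S where "S = {a :: nat \<Rightarrow> real. \<forall>i. a i \<in> {- 1 / 2..1 / 2}}"
  have w_bounds: "0 < w a i" "w a i < \<Delta>" if a: "a \<in> S" and i: "i \<le> n" for a i
  proof -
    define b where "b = 1 + (if i < n then a i else 0)"
    have "- 1 / 2 \<le> a i" "a i \<le> 1 / 2" using a by (simp_all add: S_def)
    then have b: "1 / 2 \<le> b" "b \<le> 3 / 2" by (auto simp: b_def)
    have w: "w a i = h * \<mu> i * b" by (simp add: w_def b_def)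
    then show "0 < w a i" using h(1) \<mu>[OF i] b by simp
    have "w a i \<le> h * \<mu> i * (3 / 2)"
      unfolding w using b h(1) \<mu>[OF i] by (intro mult_left_mono) auto
    then show "w a i < \<Delta>" using h(2)[OF i] by simp
  qed
  have m_pos: "m a k > 0" if "a \<in> S" "k < 2 * Suc n" for a k
    using w_bounds[OF that(1), of "k div 2"] that(2) by (auto simp: m_def)
  have m_sum: "(\<Sum>k<2 * r. m a k) = x r" for a r
    by (simp add: sum_lessThan_double m_def x \<Delta>_def)
  have m_sum_odd: "(\<Sum>k<Suc (2 * r). m a k) = x r + w a r" for a r
    using m_sum[of a r] by (simp add: m_def)
  have m_total: "(\<Sum>k<2 * Suc n. m a k) = 2 * pi" for a
    unfolding m_sum by (simp add: x)
  define F where "F j a = integral {d 0..d 0 + 2 * pi} (\<lambda>y. f y *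
      (L j (\<Sum>k<2 * Suc n. m a k * H k y) * (\<Sum>k<2 * Suc n. m a k * deriv (H k) y)))" for j a
  have F: "\<bar>F j a - h * (p j * \<mu> j * a j)\<bar> \<le> h * (\<kappa> / 2)" if "j < n" "a \<in> S" for j a
  proof -
    \<comment> \<open>The odd terms drop out because \<open>f\<close> vanishes at the odd
      centers.\<close>
    have "(\<Sum>k<2 * Suc n. f (c k) * (G j (\<Sum>l<Suc k. m a l) - G j (\<Sum>l<k. m a l)))
      = (\<Sum>i\<le>n. p i * (G j (x i + w a i) - G j (x i)))"
      unfolding sum_lessThan_double[of "\<lambda>k. f (c k) * (G j (\<Sum>l<Suc k. m a l) - G j (\<Sum>l<k. m a l))"]
        m_sum m_sum_odd lessThan_Suc_atMost[of n]
      by (intro sum.cong) (simp_all add: p_def zero)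
    moreover have "\<bar>F j a - (\<Sum>k<2 * Suc n. f (c k) * (G j (\<Sum>l<Suc k. m a l) - G j (\<Sum>l<k. m a l)))\<bar>
        \<le> h * (\<kappa> / 4)"
      unfolding F_def
      using approx[unfolded approximates_jumps_def, rule_format, of "m a" "L j" "G j"]
        m_pos[OF that(2)] m_total L LB DG that(1) less_imp_le by blast
    moreover have "\<bar>(\<Sum>i\<le>n. p i * (G j (x i + w a i) - G j (x i))) - h * (p j * \<mu> j * a j)\<bar> \<le> h * (\<kappa> / 4)"
    proof (rule h(3)[OF that(1)])
      show "\<bar>a i\<bar> \<le> 1 / 2" for i
      proof -
        have "- 1 / 2 \<le> a i" "a i \<le> 1 / 2" using that(2) by (simp_all add: S_def)
        then show ?thesis by linarith
      qed
    qed (auto simp: w_def)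
    ultimately show ?thesis by linarith
  qed
  have contF: "continuous_on S (F j)" if "j < n" for j
  proof -
    have m_cont: "continuous_on U (\<lambda>z. m (fst z) k)" for U :: "((nat \<Rightarrow> real) \<times> real) set" and k
    proof -
      have "continuous_on U (\<lambda>z. w (fst z) i)" for i
        unfolding w_def by (cases "i < n")
          (auto intro!: continuous_intros continuous_on_product_then_coordinatewise[OF continuous_on_fst])
      then show ?thesis by (cases "even k") (auto simp: m_def intro!: continuous_intros)
    qed
    have comp: "continuous_on U (\<lambda>z. g (snd z))" if "continuous_on UNIV g"
      for U :: "((nat \<Rightarrow> real) \<times> real) set" and g :: "real \<Rightarrow> real"
      using that by (rule continuous_on_compose2) (auto intro: continuous_intros)
    have "continuous_on (S \<times> cbox (d 0) (d 0 + 2 * pi)) (\<lambda>(a, y). f y *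
      (L j (\<Sum>k<2 * Suc n. m a k * H k y) * (\<Sum>k<2 * Suc n. m a k * deriv (H k) y)))"
      unfolding case_prod_unfold
      by (intro continuous_on_mult comp[OF f] continuous_on_compose2[OF L[OF that]] continuous_on_sum
          m_cont comp[OF smooth_imp_continuous[OF smH]]
          comp[OF smooth_imp_continuous[OF smooth_deriv[OF smH]]]) auto
    from integral_continuous_on_param[OF this] show ?thesis by (simp add: F_def[abs_def])
  qed
  \<comment> \<open>The factor \<open>sgn (p j)\<close> makes the diagonal coefficient positive, so
    that the signs on opposite faces come in the required order.\<close>
  obtain a where a: "a \<in> S" "\<And>j. j < n \<Longrightarrow> sgn (p j) * F j a = 0"
  proof (rule poincare_miranda[of "- 1 / 2" "1 / 2" n "\<lambda>j a. sgn (p j) * F j a", folded S_def])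
    fix j a assume j: "j < n" and "a \<in> S"
    define Q where "Q = h * (\<bar>p j\<bar> * \<mu> j)"
    have "\<bar>sgn (p j) * (F j a - h * (p j * \<mu> j * a j))\<bar> \<le> h * (\<kappa> / 2)"
      using F[OF j \<open>a \<in> S\<close>] nz[OF j] unfolding abs_mult by (simp add: p_def abs_sgn_eq)
    also have "sgn (p j) * (F j a - h * (p j * \<mu> j * a j)) = sgn (p j) * F j a - Q * a j"
      unfolding Q_def right_diff_distrib by (simp add: abs_sgn mult_ac)
    finally have near: "\<bar>sgn (p j) * F j a - Q * a j\<bar> \<le> h * \<kappa> / 2" by simp
    have Q: "h * \<kappa> \<le> Q" unfolding Q_def using \<kappa>[OF j] h(1) by (intro mult_left_mono) auto
    show "sgn (p j) * F j a \<le> 0" if "a j = - 1 / 2"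
    proof -
      have "Q * a j = - Q / 2" unfolding that by simp
      then show ?thesis using near Q by linarith
    qed
    show "sgn (p j) * F j a \<ge> 0" if "a j = 1 / 2"
    proof -
      have "Q * a j = Q / 2" unfolding that by simp
      then show ?thesis using near Q by linarith
    qed
  qed (auto intro!: continuous_on_mult_left contF)
  then have F0: "F j a = 0" if "j < n" for j
    using a(2)[OF that] nz[OF that] by (simp add: p_def sgn_zero_iff)
  define \<psi> where "\<psi> = (\<lambda>y. \<Sum>k<2 * Suc n. m a k * H k y)"
  have "(\<psi> has_real_derivative (\<Sum>k<2 * Suc n. m a k * deriv (H k) y)) (at y)" for y
    unfolding \<psi>_def using smooth_has_deriv[OF smH] by (intro DERIV_sum DERIV_cmult)
  then have d\<psi>: "deriv \<psi> y = (\<Sum>k<2 * Suc n. m a k * deriv (H k) y)" for y by (rule DERIV_imp_deriv)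
  show thesis
  proof (rule that[of \<psi>]; (intro allI impI)?)
    show "smooth \<psi>" unfolding \<psi>_def by (intro smooth_sum smooth_mult smooth_const smH)
    show "deriv \<psi> y > 0" for y
      unfolding d\<psi> by (intro sum_pos mult_pos_pos dH m_pos[OF a(1)]) auto
    show "\<psi> (d 0) = 0" by (simp add: \<psi>_def H0)
    show "\<psi> (y + 2 * pi) = \<psi> y + 2 * pi" for y
      unfolding \<psi>_def Hper using m_total[of a] by (simp only: distrib_left sum.distrib mult_1_right)
    show "integral {d 0..d 0 + 2 * pi} (\<lambda>y. f y * (L j (\<psi> y) * deriv \<psi> y)) = 0" if "j < n" for j
      using F0[OF that] unfolding F_def d\<psi> by (simp add: \<psi>_def)
  qed
qed

section \<open>Boundedness, points of alternating sign, and the final change of variables\<close>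

lemma periodic_continuous_bounded:
  fixes g :: "real \<Rightarrow> real"
  assumes "circle_fun g" "continuous_on UNIV g"
  obtains B where "B \<ge> 0" "\<And>y. \<bar>g y\<bar> \<le> B"
proof -
  interpret periodic_fun_simple g "2 * pi" by fact
  have "bounded (g ` {0..2 * pi})"
    using assms(2)
    by (intro compact_imp_bounded compact_continuous_image) (auto elim: continuous_on_subset)
  then obtain B where B: "\<And>y. y \<in> {0..2 * pi} \<Longrightarrow> \<bar>g y\<bar> \<le> B"
    unfolding bounded_iff by (metis imageI real_norm_def)
  have "\<bar>g y\<bar> \<le> B" for y
  proof -
    define k where "k = \<lfloor>y / (2 * pi)\<rfloor>"
    have "of_int k \<le> y / (2 * pi)" "y / (2 * pi) \<le> of_int k + 1" unfolding k_def by linarith+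
    then have "y - of_int k * (2 * pi) \<in> {0..2 * pi}" by (simp add: field_simps)
    from B[OF this] show ?thesis by (simp only: minus_of_int)
  qed
  then show thesis using that[of B] abs_ge_zero[of "g 0"] order_trans by blast
qed

text \<open>
  Even indices carry points of alternating sign, odd indices the zeros of \<open>f\<close> between them.
\<close>

lemma sign_changes_centers:
  assumes "circle_fun f" "continuous_on UNIV f" "at_least_sign_changes (n + 1) f"
  obtains c d :: "nat \<Rightarrow> real" where
    "\<forall>k<2 * Suc n. d k < c k \<and> c k < d (Suc k)" "d (2 * Suc n) = d 0 + 2 * pi"
    "\<forall>i\<le>n. f (c (Suc (2 * i))) = 0"
    "\<forall>i\<le>n. (- 1) ^ (n - i) * f (c (2 * i)) * f (c (2 * n)) > 0"
proof -
  interpret periodic_fun_simple f "2 * pi" by fact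
  obtain t where t: "strict_mono_on {..<n + 1} t" "\<And>i. i < n + 1 \<Longrightarrow> t i < t 0 + 2 * pi"
    "\<And>i. i < n + 1 \<Longrightarrow> f (t i) * f (t (Suc i mod (n + 1))) < 0"
    using assms(3) unfolding at_least_sign_changes_def by metis
  \<comment> \<open>Closing the cycle with \<open>t 0 + 2 * pi\<close> turns the cyclic condition
    into \<open>n + 1\<close> sign changes between consecutive reals.\<close>
  define T where "T i = (if i \<le> n then t i else t 0 + 2 * pi)" for i
  have T_less: "T i < T (Suc i)" if "i \<le> n" for i
    using t(1,2) that by (auto simp: T_def strict_mono_on_def)
  have fT: "f (T i) * f (T (Suc i)) < 0" if "i \<le> n" for i
    using t(3)[of i] that plus_period[of "t 0"] by (cases "i = n") (auto simp: T_def)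
  have "\<exists>z. T i < z \<and> z < T (Suc i) \<and> f z = 0" if i: "i \<le> n" for i
  proof -
    have "continuous_on {T i..T (Suc i)} f" using assms(2) by (auto elim: continuous_on_subset)
    then obtain z where z: "T i \<le> z" "z \<le> T (Suc i)" "f z = 0"
      using same_sign_if_no_zero[of "T i" "T (Suc i)" f] fT[OF i] T_less[OF i] by force
    have "z \<noteq> T i" "z \<noteq> T (Suc i)" using fT[OF i] z(3) by auto
    then show ?thesis using z by force
  qed
  then obtain z where z: "\<And>i. i \<le> n \<Longrightarrow> T i < z i \<and> z i < T (Suc i) \<and> f (z i) = 0" by metis
  define c where "c k = (if even k then T (k div 2) else z (k div 2))" for k
  have c_less: "c k < c (Suc k)" if "k < 2 * Suc n" for k
    using z[of "k div 2"] that by (auto simp: c_def elim!: oddE)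
  have cK: "c (2 * Suc n) = c 0 + 2 * pi" by (simp add: c_def T_def)
  \<comment> \<open>Midpoints of consecutive centers; \<open>d 0\<close> is the last midpoint moved
    back by one period, so that the cells tile exactly one period.\<close>
  define d where "d k = (if k = 0 then (c (Suc (2 * n)) + c (2 * Suc n)) / 2 - 2 * pi
    else (c (k - 1) + c k) / 2)" for k
  have sgn: "j \<le> n \<Longrightarrow> (- 1) ^ j * f (T (n - j)) * f (T n) > 0" for j
  proof (induction j)
    case 0
    then show ?case using fT[of n] by (auto simp: zero_less_mult_iff mult_less_0_iff)
  next
    case (Suc j)
    have "Suc (n - Suc j) = n - j" using Suc by simp
    then have "f (T (n - Suc j)) * f (T (n - j)) < 0" using fT[of "n - Suc j"] by simp
    with Suc show ?case by (auto simp: zero_less_mult_iff mult_less_0_iff)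
  qed
  show thesis
  proof (rule that[of d c]; (intro allI impI)?)
    show "d k < c k \<and> c k < d (Suc k)" if "k < 2 * Suc n" for k
    proof -
      have "d k < c k"
      proof (cases k)
        case 0
        then show ?thesis using c_less[of "Suc (2 * n)"] cK by (simp add: d_def field_simps)
      next
        case (Suc l)
        then show ?thesis using c_less[of l] that by (simp add: d_def)
      qed
      then show ?thesis using c_less[OF that] by (simp add: d_def)
    qed
    show "d (2 * Suc n) = d 0 + 2 * pi" by (simp add: d_def)
    show "f (c (Suc (2 * i))) = 0" if "i \<le> n" for i using z[OF that] by (simp add: c_def)
    show "(- 1) ^ (n - i) * f (c (2 * i)) * f (c (2 * n)) > 0" if "i \<le> n" for i
      using sgn[of "n - i"] that by (simp add: c_def)
  qed
qed

theorem theorem1: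
  fixes n :: nat and V :: "(real \<Rightarrow> real) set" and f :: "real \<Rightarrow> real"
  assumes "n \<ge> 1" and "odd n"
    and "chebyshev_system n V"
    and "circle_fun f" and "continuous_on UNIV f"
    and "at_least_sign_changes (n + 1) f"
  shows "\<exists>\<phi>. circle_diffeomorphism \<phi> \<and> orientation_preserving \<phi> \<and>
    (\<forall>g\<in>V. ((\<lambda>x. f (\<phi> x) * g x) has_integral 0) {0..2 * pi})"
proof -
  note cheb = \<open>chebyshev_system n V\<close> and f_cont = \<open>continuous_on UNIV f\<close>
  from sign_changes_centers[OF assms(4-6)] obtain c d :: "nat \<Rightarrow> real" where
    cd: "\<forall>k<2 * Suc n. d k < c k \<and> c k < d (Suc k)" and dK: "d (2 * Suc n) = d 0 + 2 * pi"
    and zero: "\<forall>i\<le>n. f (c (Suc (2 * i))) = 0"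
    and "\<forall>i\<le>n. (- 1) ^ (n - i) * f (c (2 * i)) * f (c (2 * n)) > 0" .
  then have sgn: "(- 1) ^ (n - i) * f (c (2 * i)) * f (c (2 * n)) > 0" if "i \<le> n" for i
    using that by blast
  define x where "x i = 2 * pi / Suc n * i" for i :: nat
  have x_mono: "strict_mono x" by (rule strict_monoI) (simp add: x_def divide_strict_right_mono)
  have x_range: "x i \<in> {0..<2 * pi}" if "i \<le> n" for i
  proof -
    have "2 * pi / Suc n * i < 2 * pi / Suc n * Suc n"
      using that by (intro mult_strict_left_mono) auto
    then show ?thesis by (simp add: x_def)
  qed
  have "inj_on x {..<n}" using inj_on_subset[OF strict_mono_imp_inj_on[OF x_mono, of UNIV]] by simp
  moreover have "x ` {..<n} \<subseteq> {0..<2 * pi}" using x_range by (simp add: image_subset_iff)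
  ultimately obtain L :: "nat \<Rightarrow> real \<Rightarrow> real" where "\<forall>j<n. L j \<in> V"
    "\<forall>i<n. \<forall>j<n. L j (x i) = (if i = j then 1 else 0)"
    and interp: "\<forall>g\<in>V. \<forall>y. g y = (\<Sum>j<n. g (x j) * L j y)"
    by (rule chebyshev_system_interpolation[OF cheb])
  then have L: "j < n \<Longrightarrow> L j \<in> V"
    and Lx: "i < n \<Longrightarrow> j < n \<Longrightarrow> L j (x i) = (if i = j then 1 else 0)" for i j
    by blast+
  have V_cont: "continuous_on UNIV g" if "g \<in> V" for g
    by (rule chebyshev_system_continuous[OF cheb that])
  have V_per: "circle_fun g" if "g \<in> V" for g using cheb that by (simp add: chebyshev_system_def)
  have Ln: "(- 1) ^ (n - 1 - j) * L j (x n) > 0" if "j < n" for j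
  proof (rule chebyshev_system_interpolation_sign[OF cheb _ _ L[OF that] that])
    show "strict_mono_on {..n} x" using x_mono by (auto simp: strict_mono_on_def strict_mono_def)
    show "x ` {..n} \<subseteq> {0..<2 * pi}" using x_range by (simp add: image_subset_iff)
  qed (use Lx that in simp)
  have "\<exists>b\<ge>0. \<forall>y. \<bar>L j y\<bar> \<le> b" if "j < n" for j
    using periodic_continuous_bounded[OF V_per V_cont] L[OF that] by metis
  then obtain b where b: "\<And>j. j < n \<Longrightarrow> b j \<ge> 0 \<and> (\<forall>y. \<bar>L j y\<bar> \<le> b j)" by metis
  define B where "B = (\<Sum>j<n. b j)"
  have b_le: "b j \<le> B" if "j < n" for j
    unfolding B_def using b that by (intro member_le_sum) auto
  have "B \<ge> 0" unfolding B_def using b by (intro sum_nonneg) auto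
  have LB: "\<bar>L j y\<bar> \<le> B" if "j < n" for j y using b[OF that] b_le[OF that] order_trans by blast
  define s where "s = sgn (f (c (2 * n)))"
  have fn: "f (c (2 * n)) \<noteq> 0" using sgn[of n] by auto
  \<comment> \<open>The relation for \<open>L j\<close> reduces to f(c(2j)) \<mu>(j) + f(c(2n))
    \<mu>(n) L(j)(x(n)) = 0, solved here with \<open>f (c (2 * n)) * \<mu> n = s\<close>, a sign
    that makes \<open>\<mu> n\<close> positive. The others are positive since
    \<open>f (c (2 * j))\<close> and \<open>L j (x n)\<close> both alternate in \<open>j\<close>,
    and the offset between the exponents \<open>n - j\<close> and \<open>n - 1 - j\<close> absorbs
    the minus sign.\<close>
  define \<mu> where "\<mu> i = (if i < n then - s * L i (x n) / f (c (2 * i)) else s / f (c (2 * n)))" for i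
  have nz: "f (c (2 * i)) \<noteq> 0" if "i \<le> n" for i using sgn[OF that] by auto
  have \<mu>_pos: "\<mu> i > 0" if "i \<le> n" for i
  proof (cases "i < n")
    case True
    then have "(- 1 :: real) ^ (n - i) = - ((- 1) ^ (n - 1 - i))"
      by (metis (no_types, opaque_lifting) Suc_diff_Suc diff_Suc_eq_diff_pred mult_minus1 power_Suc)
    then have "(- 1) ^ (n - 1 - i) * f (c (2 * i)) * f (c (2 * n)) < 0" using sgn[OF that] by simp
    with Ln[OF True] have "L i (x n) * f (c (2 * i)) * f (c (2 * n)) < 0"
      by (auto simp: zero_less_mult_iff mult_less_0_iff)
    then show ?thesis using True
      by (auto simp: \<mu>_def s_def sgn_real_def zero_less_mult_iff mult_less_0_iff zero_less_divide_iff divide_less_0_iff)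
  next
    case False
    then show ?thesis using fn by (auto simp: \<mu>_def s_def sgn_real_def zero_less_divide_iff)
  qed
  have rel: "(\<Sum>i\<le>n. f (c (2 * i)) * \<mu> i * L j (x i)) = 0" if j: "j < n" for j
  proof -
    have "(\<Sum>i<n. f (c (2 * i)) * \<mu> i * L j (x i)) = (\<Sum>i<n. if i = j then - s * L j (x n) else 0)"
      using nz Lx j by (intro sum.cong) (auto simp: \<mu>_def)
    also have "\<dots> = - s * L j (x n)" using j by simp
    finally have "(\<Sum>i<n. f (c (2 * i)) * \<mu> i * L j (x i)) = - s * L j (x n)" .
    moreover have "f (c (2 * n)) * \<mu> n = s" using fn by (simp add: \<mu>_def)
    ultimately show ?thesis by (simp add: lessThan_Suc_atMost[symmetric])
  qed
  from exists_orthogonal_masses[OF f_cont cd[rule_format] dK zero[rule_format] nz[OF less_imp_le] x_def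
      V_cont[OF L] LB Lx \<mu>_pos rel \<open>B \<ge> 0\<close>] \<open>n \<ge> 1\<close>
  obtain \<psi> where \<psi>: "smooth \<psi>" "\<forall>y. deriv \<psi> y > 0" "\<psi> (d 0) = 0" "\<forall>y. \<psi> (y + 2 * pi) = \<psi> y + 2 * pi"
    and orth: "\<forall>j<n. integral {d 0..d 0 + 2 * pi} (\<lambda>y. f y * (L j (\<psi> y) * deriv \<psi> y)) = 0"
    by auto
  note \<psi> = \<psi>(1) \<psi>(2)[rule_format] \<psi>(3) \<psi>(4)[rule_format]
  obtain \<phi> where \<phi>: "circle_diffeomorphism \<phi>" "orientation_preserving \<phi>"
    "\<And>y. \<phi> (\<psi> y) = y" "\<And>y. \<psi> (\<phi> y) = y"
    using circle_diffeomorphism_inverse[OF \<psi>(1,2,4)] by blast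
  have cont\<phi>: "continuous_on UNIV \<phi>"
    using \<phi>(1) by (auto simp: circle_diffeomorphism_def smooth_circle_map_def intro: smooth_imp_continuous)
  have D\<psi>: "(\<psi> has_real_derivative deriv \<psi> y) (at y)" for y by (rule smooth_has_deriv[OF \<psi>(1)])
  have mono\<psi>: "\<psi> x \<le> \<psi> y" if "x \<le> y" for x y
    by (rule DERIV_nonneg_imp_nondecreasing[OF that]) (use D\<psi> \<psi>(2) less_imp_le in blast)
  have end\<psi>: "\<psi> (d 0 + 2 * pi) = 2 * pi" using \<psi>(3,4) by simp
  have "((\<lambda>x. f (\<phi> x) * g x) has_integral 0) {0..2 * pi}" if g: "g \<in> V" for g
  proof -
    have cont: "continuous_on S (\<lambda>x. f (\<phi> x) * g x)" for S
      using continuous_on_compose2[OF f_cont cont\<phi>] V_cont[OF g]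
      by (intro continuous_on_mult) (auto elim: continuous_on_subset)
    have cont\<psi>: "continuous_on UNIV \<psi>" "continuous_on UNIV (deriv \<psi>)"
      using \<psi>(1) by (auto intro: smooth_imp_continuous smooth_deriv)
    have int: "((\<lambda>y. f y * (L j (\<psi> y) * deriv \<psi> y)) has_integral 0) {d 0..d 0 + 2 * pi}" if "j < n" for j
    proof -
      have "continuous_on UNIV (\<lambda>y. f y * (L j (\<psi> y) * deriv \<psi> y))"
        using continuous_on_compose2[OF V_cont[OF L[OF that]] cont\<psi>(1)]
        by (intro continuous_on_mult f_cont cont\<psi>(2)) auto
      then have "(\<lambda>y. f y * (L j (\<psi> y) * deriv \<psi> y)) integrable_on {d 0..d 0 + 2 * pi}"
        by (intro integrable_continuous_interval) (auto elim: continuous_on_subset)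
      then show ?thesis using orth[rule_format, OF that] by (metis integrable_integral)
    qed
    \<comment> \<open>Expanding \<open>g\<close> in the interpolating functions reduces
      orthogonality to \<open>V\<close> to the \<open>n\<close> equations already solved.\<close>
    have "((\<lambda>y. \<Sum>j<n. g (x j) * (f y * (L j (\<psi> y) * deriv \<psi> y))) has_integral (\<Sum>j<n. g (x j) * 0))
        {d 0..d 0 + 2 * pi}"
      by (intro has_integral_sum has_integral_mult_right int) auto
    moreover have "(\<Sum>j<n. g (x j) * (f y * (L j (\<psi> y) * deriv \<psi> y))) = deriv \<psi> y *\<^sub>R (f (\<phi> (\<psi> y)) * g (\<psi> y))" for y
      unfolding interp[rule_format, OF g, of "\<psi> y"] \<phi>(3) by (simp add: sum_distrib_left mult_ac)
    ultimately have "((\<lambda>y. deriv \<psi> y *\<^sub>R (f (\<phi> (\<psi> y)) * g (\<psi> y))) has_integral 0) {d 0..d 0 + 2 * pi}"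
      by simp
    \<comment> \<open>The substitution x = \<psi>(y); the normalisation
      \<open>\<psi> (d 0) = 0\<close> makes the new domain exactly
      \<open>{0..2 * pi}\<close>.\<close>
    moreover have "((\<lambda>y. deriv \<psi> y *\<^sub>R (f (\<phi> (\<psi> y)) * g (\<psi> y))) has_integral
        integral {\<psi> (d 0)..\<psi> (d 0 + 2 * pi)} (\<lambda>x. f (\<phi> x) * g x)) {d 0..d 0 + 2 * pi}"
    proof (rule has_integral_substitution[where c = 0 and d = "2 * pi"])
      show "\<psi> (d 0) \<le> \<psi> (d 0 + 2 * pi)" by (intro mono\<psi>) simp
      show "\<psi> ` {d 0..d 0 + 2 * pi} \<subseteq> {0..2 * pi}"
        using mono\<psi>[of "d 0"] mono\<psi>[of _ "d 0 + 2 * pi"] \<psi>(3) end\<psi> by auto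
    qed (use D\<psi> cont in \<open>auto intro: has_field_derivative_at_within\<close>)
    ultimately have "integral {0..2 * pi} (\<lambda>x. f (\<phi> x) * g x) = 0"
      unfolding \<psi>(3) end\<psi> by (rule has_integral_unique[symmetric])
    then show ?thesis
      using integrable_integral[OF integrable_continuous_interval[OF cont]] by metis
  qed
  then show ?thesis using \<phi>(1,2) by blast
qed

end
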